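(* Let $N\geqslant1$ and let $d\geqslant 1$ be a fixed integer. Then for every $k\geqslant d-1$ and every $\underline{\underline{\alpha}}\in\mathcal{B}^{N+}$ with $M(\underline{\underline{\alpha}})\leqslant d-1$, one has $$\det\Delta_0(\underline{\underline{\alpha}})\in H^0\big(\mathbb{P}^N,\,E^{\mathrm{GG}}_{k,\infty}(d)\big).$$ In addition, these $\det\Delta_0(\underline{\underline{\alpha}})$ are linearly independent, and hence $$\dim H^0\big(\mathbb{P}^N,\,E^{\mathrm{GG}}_{k,\infty}(d)\big)\geqslant (N+1)^d .$$
   Context: Let $[X_0:\dots:X_N]$ be homogeneous coordinates on $\mathbb{P}^N=\mathbb{P}^N(\mathbb{C})$ and $U_i=\{X_i\neq 0\}$, with affine coordinates $X_j/X_i$ ($j\neq i$); on $U_0$ write $x_{0j}=X_j/X_0$. Green-Griffiths bundle $E^{\mathrm{GG}}_{k,n}$ (jet order $k$, weight $n$): in a chart with coordinates $(x_1,\dots,x_N)$, introduce formal jet variables $x_i^{(l)}$, $1\leqslant l\leqslant k$, of weight $l$. A local holomorphic section over an open set $V$ of the chart is a polynomial in these jet variables, with coefficients holomorphic on $V$, all of whose monomials have weight $n$. If $y_t=\Psi_t(x_1,\dots,x_N)$ is a change of charts, $y_t^{(l)}$ is identified with $(\Psi_t(x_1,\dots,x_N))^{(l)}$, computed by formal differentiation with the chain rule. Put $E^{\mathrm{GG}}_{k,\infty}(d)=\bigoplus_{n\geqslant0}E^{\mathrm{GG}}_{k,n}\otimes\mathcal{O}(d)$. A global section of it is a tuple $(s_0,\dots,s_N)$,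 with $s_i$ a polynomial in the jet variables of $U_i$ with coefficients holomorphic on $U_i$, such that $s_i=(X_j/X_i)^d s_j$ on $U_i\cap U_j$ after the change of charts. A polynomial $P$ in the variables $x_{0i}^{(l)}$, $0\leqslant l\leqslant k$, is said to belong to $H^0(\mathbb{P}^N,E^{\mathrm{GG}}_{k,\infty}(d))$ if there is a (necessarily unique) global section with $s_0=P$. $\mathcal{B}^{N+}$ is the set of $N$-tuples $\underline{\underline{\alpha}}=(\underline{\alpha}^1,\dots,\underline{\alpha}^N)$ of finite (possibly empty) strictly increasing sequences $\underline{\alpha}^j=(\alpha^j_1<\dots<\alpha^j_{n_j})$ of integers $\geqslant 0$ such that, with $s_{N+1}=0$ and $s_j=n_N+\dots+n_j$, one has $\alpha^j_i\geqslant s_{j+1}$ for all $j,i$. $M(\underline{\underline{\alpha}})=\max_{j,i}\alpha^j_i$, with $M=-1$ if all sequences are empty. The column $\mathcal{C}_\alpha(\chi)$ has $l$-th entry $\binom{\alpha}{l-1}\chi^{(\alpha-l+1)}$ ($l\geqslant 1$), interpreted as $0$ if $l-1>\alpha$. $\Delta_0(\underline{\underline{\alpha}})$ is the square matrix of size $s_1=n_1+\dots+n_N$ with columns, from left to right, $\mathcal{C}_{\alpha^N_1}(x_{0N}),\dots,\mathcal{C}_{\alpha^N_{n_N}}(x_{0N}),\mathcal{C}_{\alpha^{N-1}_1}(x_{0,N-1}),\dots,\mathcal{C}_{\alpha^1_{n_1}}(x_{01})$, truncated to length $s_1$. The empty determinant is $1$. *)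

theory Defs
  imports
    "HOL-Analysis.Analysis"
    "HOL-Library.Poly_Mapping"
    "HOL-Library.Function_Algebras"
    "HOL-Library.Extended_Nat"
    "Jordan_Normal_Form.Determinant"
begin

section \<open>Polynomials in jet variables\<close>

text \<open>The pair \<open>(t, l)\<close> stands for the jet variable \<open>x\<^sub>t\<^sup>(\<^sup>l\<^sup>)\<close>. The coefficient ring \<open>'a\<close> is either
  \<open>complex\<close> or a ring of functions with pointwise operations.\<close>

type_synonym jvar = "nat \<times> nat"
type_synonym 'a jpoly = "(jvar \<Rightarrow>\<^sub>0 nat) \<Rightarrow>\<^sub>0 'a"

definition Cst :: "'a::comm_ring_1 \<Rightarrow> 'a jpoly" where
  "Cst c = Poly_Mapping.single 0 c"

definition Var :: "jvar \<Rightarrow> 'a::comm_ring_1 jpoly" where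
  "Var v = Poly_Mapping.single (Poly_Mapping.single v 1) 1"

text \<open>Apply \<open>\<phi>\<close> to the coefficients and replace every variable \<open>v\<close> by \<open>\<sigma> v\<close>.\<close>

definition jsubst :: "('a::comm_ring_1 \<Rightarrow> 'b::comm_ring_1) \<Rightarrow> (jvar \<Rightarrow> 'b) \<Rightarrow> 'a jpoly \<Rightarrow> 'b" where
  "jsubst \<phi> \<sigma> p =
     (\<Sum>m\<in>Poly_Mapping.keys p. \<phi> (Poly_Mapping.lookup p m) *
        (\<Prod>v\<in>Poly_Mapping.keys m. \<sigma> v ^ Poly_Mapping.lookup m v))"


section \<open>Charts of projective space\<close>

text \<open>A point of \<open>U\<^sub>i = {X\<^sub>i \<noteq> 0}\<close> is given by its affine coordinates \<open>x t = X\<^sub>t / X\<^sub>i\<close>; the entry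
  \<open>x i\<close>, which is not a coordinate, is normalised to \<open>1 = X\<^sub>i / X\<^sub>i\<close>, and entries beyond \<open>N\<close> are \<open>0\<close>.
  With the product topology of \<open>nat \<Rightarrow> complex\<close>, this is a copy of \<open>N\<close>-dimensional affine space.\<close>

type_synonym point = "nat \<Rightarrow> complex"

definition chart :: "nat \<Rightarrow> nat \<Rightarrow> point set" where
  "chart N i = {x. x i = 1 \<and> (\<forall>t>N. x t = 0)}"

definition coords :: "nat \<Rightarrow> nat \<Rightarrow> nat set" where
  "coords N i = {..N} - {i}"

text \<open>The open set \<open>U\<^sub>i \<inter> U\<^sub>j\<close> as seen in the chart \<open>U\<^sub>i\<close>, and the change of charts to \<open>U\<^sub>j\<close>, namely
  \<open>X\<^sub>t / X\<^sub>j = (X\<^sub>t / X\<^sub>i) / (X\<^sub>j / X\<^sub>i)\<close>.\<close>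

definition overlap :: "nat \<Rightarrow> nat \<Rightarrow> nat \<Rightarrow> point set" where
  "overlap N i j = {x \<in> chart N i. x j \<noteq> 0}"

definition transition :: "nat \<Rightarrow> point \<Rightarrow> point" where
  "transition j x = (\<lambda>t. x t / x j)"

text \<open>Holomorphic functions of several variables on an open subset \<open>V\<close> of the chart \<open>U\<^sub>i\<close>:
  continuous, and holomorphic in each affine coordinate separately.\<close>

definition hol_on_chart :: "nat \<Rightarrow> nat \<Rightarrow> point set \<Rightarrow> (point \<Rightarrow> complex) \<Rightarrow> bool" where
  "hol_on_chart N i V f \<longleftrightarrow>
     continuous_on V f \<and>
     (\<forall>x\<in>V. \<forall>t\<in>coords N i. (\<lambda>z. f (x(t := z))) field_differentiable at (x t))"

definition partial_deriv :: "nat \<Rightarrow> (point \<Rightarrow> complex) \<Rightarrow> point \<Rightarrow> complex" where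
  "partial_deriv t f x = deriv (\<lambda>z. f (x(t := z))) (x t)"


section \<open>Green--Griffiths jet differentials\<close>

text \<open>Formal differentiation in the chart \<open>U\<^sub>i\<close>: the derivation with
  \<open>f \<mapsto> \<Sum>\<^sub>t (\<partial>f/\<partial>x\<^sub>t) x\<^sub>t\<^sup>(\<^sup>1\<^sup>)\<close> on coefficients and \<open>x\<^sub>t\<^sup>(\<^sup>l\<^sup>) \<mapsto> x\<^sub>t\<^sup>(\<^sup>l\<^sup>+\<^sup>1\<^sup>)\<close> on jet variables.\<close>

definition total_deriv :: "nat \<Rightarrow> nat \<Rightarrow> (point \<Rightarrow> complex) jpoly \<Rightarrow> (point \<Rightarrow> complex) jpoly" where
  "total_deriv N i p =
     (\<Sum>m\<in>Poly_Mapping.keys p.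
        (\<Sum>t\<in>coords N i.
           Poly_Mapping.single (m + Poly_Mapping.single (t, 1) 1)
             (partial_deriv t (Poly_Mapping.lookup p m)))
      + (\<Sum>(t, l)\<in>Poly_Mapping.keys m.
           Poly_Mapping.single
             (m - Poly_Mapping.single (t, l) 1 + Poly_Mapping.single (t, Suc l) 1)
             (of_nat (Poly_Mapping.lookup m (t, l)) * Poly_Mapping.lookup p m)))"

text \<open>Expression in the chart \<open>U\<^sub>i\<close> of a jet polynomial of the chart \<open>U\<^sub>j\<close>: the variable
  \<open>y\<^sub>t\<^sup>(\<^sup>l\<^sup>)\<close> becomes the \<open>l\<close>-th formal derivative of \<open>y\<^sub>t = x\<^sub>t / x\<^sub>j\<close>. Only the values of the coefficients
  on the overlap are meaningful.\<close>

definition change_chart :: "nat \<Rightarrow> nat \<Rightarrow> nat \<Rightarrow> (point \<Rightarrow> complex) jpoly \<Rightarrow> (point \<Rightarrow> complex) jpoly" where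
  "change_chart N i j =
     jsubst (\<lambda>f. Cst (f \<circ> transition j))
            (\<lambda>(t, l). (total_deriv N i ^^ l) (Cst (\<lambda>x. transition j x t)))"

text \<open>Sections of \<open>\<Oplus>\<^sub>n E\<^sup>G\<^sup>G\<^sub>k\<^sub>,\<^sub>n\<close> over the chart \<open>U\<^sub>i\<close>. Every polynomial is the finite sum of its components
  that are homogeneous for the weight, so the direct sum over all weights imposes no condition.
  Coefficients are functions on all of \<open>nat \<Rightarrow> complex\<close>; they are required to vanish off the
  chart so that each section has a single representative.\<close>

definition GG_chart_sections :: "nat \<Rightarrow> nat \<Rightarrow> nat \<Rightarrow> (point \<Rightarrow> complex) jpoly set" where
  "GG_chart_sections N k i =
     {p. \<forall>m\<in>Poly_Mapping.keys p.
           Poly_Mapping.keys m \<subseteq> coords N i \<times> {1..k} \<and>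
           hol_on_chart N i (chart N i) (Poly_Mapping.lookup p m) \<and>
           (\<forall>x. x \<notin> chart N i \<longrightarrow> Poly_Mapping.lookup p m x = 0)}"

text \<open>The global sections of \<open>\<Oplus>\<^sub>n E\<^sup>G\<^sup>G\<^sub>k\<^sub>,\<^sub>n \<otimes> \<O>(d)\<close>, as tuples \<open>(s\<^sub>0, \<dots>, s\<^sub>N)\<close> with
  \<open>s\<^sub>i = (X\<^sub>j / X\<^sub>i)\<^sup>d s\<^sub>j\<close> on \<open>U\<^sub>i \<inter> U\<^sub>j\<close>.\<close>

definition H0_GG :: "nat \<Rightarrow> nat \<Rightarrow> nat \<Rightarrow> (nat \<Rightarrow> (point \<Rightarrow> complex) jpoly) set" where
  "H0_GG N k d =
     {s. (\<forall>i\<le>N. s i \<in> GG_chart_sections N k i) \<and> (\<forall>i>N. s i = 0) \<and>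
         (\<forall>i\<le>N. \<forall>j\<le>N. \<forall>x\<in>overlap N i j. \<forall>m.
            Poly_Mapping.lookup (s i) m x =
              x j ^ d * Poly_Mapping.lookup (change_chart N i j (s j)) m x)}"

text \<open>A complex polynomial in the variables \<open>x\<^sub>0\<^sub>t\<^sup>(\<^sup>l\<^sup>)\<close> with \<open>l \<ge> 0\<close>, read as a jet polynomial on \<open>U\<^sub>0\<close>:
  the variable \<open>x\<^sub>0\<^sub>t\<^sup>(\<^sup>0\<^sup>)\<close> is the coordinate function \<open>x\<^sub>0\<^sub>t\<close>.\<close>

definition restrict_coeffs :: "point set \<Rightarrow> (point \<Rightarrow> complex) jpoly \<Rightarrow> (point \<Rightarrow> complex) jpoly" where
  "restrict_coeffs V = Poly_Mapping.map (\<lambda>f x. if x \<in> V then f x else 0)"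

definition jet_poly_on_U0 :: "nat \<Rightarrow> complex jpoly \<Rightarrow> (point \<Rightarrow> complex) jpoly" where
  "jet_poly_on_U0 N P =
     restrict_coeffs (chart N 0)
       (jsubst (\<lambda>c. Cst (\<lambda>x. c))
               (\<lambda>(t, l). if l = 0 then Cst (\<lambda>x. x t) else Var (t, l)) P)"

definition belongs_H0 :: "nat \<Rightarrow> nat \<Rightarrow> nat \<Rightarrow> complex jpoly \<Rightarrow> bool" where
  "belongs_H0 N k d P \<longleftrightarrow>
     (\<forall>m\<in>Poly_Mapping.keys P. Poly_Mapping.keys m \<subseteq> {1..N} \<times> {0..k}) \<and>
     (\<exists>s\<in>H0_GG N k d. s 0 = jet_poly_on_U0 N P)"


section \<open>The determinants\<close>

text \<open>An \<open>N\<close>-tuple of sequences is a function \<open>\<alpha>\<close> with \<open>\<alpha> j\<close> the \<open>j\<close>-th sequence for \<open>1 \<le> j \<le> N\<close>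
  and \<open>\<alpha> j = []\<close> for all other \<open>j\<close>.\<close>

definition tail_length :: "nat \<Rightarrow> (nat \<Rightarrow> nat list) \<Rightarrow> nat \<Rightarrow> nat" where
  "tail_length N \<alpha> j = (\<Sum>t=j..N. length (\<alpha> t))"

definition BNplus :: "nat \<Rightarrow> (nat \<Rightarrow> nat list) set" where
  "BNplus N =
     {\<alpha>. (\<forall>j. j \<notin> {1..N} \<longrightarrow> \<alpha> j = []) \<and>
         (\<forall>j\<in>{1..N}. sorted_wrt (<) (\<alpha> j) \<and>
            (\<forall>a\<in>set (\<alpha> j). tail_length N \<alpha> (Suc j) \<le> a))}"

definition max_entry :: "nat \<Rightarrow> (nat \<Rightarrow> nat list) \<Rightarrow> int" where
  "max_entry N \<alpha> =
     (if \<forall>j\<in>{1..N}. \<alpha> j = [] then -1 else int (Max (\<Union>j\<in>{1..N}. set (\<alpha> j))))"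

text \<open>The pairs \<open>(j, \<alpha>\<^sup>j\<^sub>i)\<close> in the order of the columns of \<open>\<Delta>\<^sub>0\<close>: \<open>j\<close> runs from \<open>N\<close> down to \<open>1\<close>.\<close>

definition column_list :: "nat \<Rightarrow> (nat \<Rightarrow> nat list) \<Rightarrow> (nat \<times> nat) list" where
  "column_list N \<alpha> = concat (map (\<lambda>j. map (Pair j) (\<alpha> j)) (rev [1..<Suc N]))"

text \<open>Entry of the column \<open>\<C>\<^sub>a(x\<^sub>0\<^sub>j)\<close>; rows are counted from \<open>0\<close>, so \<open>r = l - 1\<close>.\<close>

definition column_entry :: "nat \<Rightarrow> nat \<Rightarrow> nat \<Rightarrow> complex jpoly" where
  "column_entry j a r = (if r \<le> a then of_nat (a choose r) * Var (j, a - r) else 0)"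

definition Delta0 :: "nat \<Rightarrow> (nat \<Rightarrow> nat list) \<Rightarrow> complex jpoly mat" where
  "Delta0 N \<alpha> =
     mat (tail_length N \<alpha> 1) (tail_length N \<alpha> 1)
       (\<lambda>(r, c). case column_list N \<alpha> ! c of (j, a) \<Rightarrow> column_entry j a r)"

definition det_Delta0 :: "nat \<Rightarrow> (nat \<Rightarrow> nat list) \<Rightarrow> complex jpoly" where
  "det_Delta0 N \<alpha> = Determinant.det (Delta0 N \<alpha>)"


section \<open>Complex vector space structures\<close>

definition jpoly_scale :: "complex \<Rightarrow> complex jpoly \<Rightarrow> complex jpoly" where
  "jpoly_scale c P = Cst c * P"

definition section_scale ::
    "complex \<Rightarrow> (nat \<Rightarrow> (point \<Rightarrow> complex) jpoly) \<Rightarrow> nat \<Rightarrow> (point \<Rightarrow> complex) jpoly" where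
  "section_scale c s = (\<lambda>i. Cst (\<lambda>x. c) * s i)"

lemma Cst_add: "Cst (a + b) = Cst a + Cst b"
  by (simp add: Cst_def single_add)

lemma Cst_mult: "Cst (a * b) = Cst a * Cst b"
  by (simp add: Cst_def mult_single)

lemma Cst_one: "Cst 1 = 1"
  by (simp add: Cst_def)

global_interpretation jpoly_space: vector_space jpoly_scale
  by unfold_locales
    (simp_all add: jpoly_scale_def Cst_add Cst_mult Cst_one algebra_simps)

global_interpretation section_space: vector_space section_scale
proof unfold_locales
  fix a b :: complex and s t :: "nat \<Rightarrow> (point \<Rightarrow> complex) jpoly"
  have add: "Cst (\<lambda>x::point. a + b) = Cst (\<lambda>x. a) + Cst (\<lambda>x. b)"
    using Cst_add[of "\<lambda>x::point. a" "\<lambda>x. b"] by (simp add: plus_fun_def)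
  have mult: "Cst (\<lambda>x::point. a * b) = Cst (\<lambda>x. a) * Cst (\<lambda>x. b)"
    using Cst_mult[of "\<lambda>x::point. a" "\<lambda>x. b"] by (simp add: times_fun_def)
  have one: "Cst (\<lambda>x::point. 1 :: complex) = 1"
    using Cst_one[where 'a = "point \<Rightarrow> complex"] by (simp add: one_fun_def)
  show "section_scale a (s + t) = section_scale a s + section_scale a t"
    by (simp add: section_scale_def fun_eq_iff algebra_simps)
  show "section_scale (a + b) s = section_scale a s + section_scale b s"
    by (simp add: section_scale_def fun_eq_iff add algebra_simps)
  show "section_scale a (section_scale b s) = section_scale (a * b) s"
    by (simp add: section_scale_def fun_eq_iff mult algebra_simps)
  show "section_scale 1 s = s"
    by (simp add: section_scale_def fun_eq_iff one)
qed

text \<open>The library's \<open>dim\<close> is a natural number also in the infinite-dimensional case.\<close>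

definition section_edim :: "(nat \<Rightarrow> (point \<Rightarrow> complex) jpoly) set \<Rightarrow> enat" where
  "section_edim V =
     (if \<exists>B. finite B \<and> V \<subseteq> section_space.span B then enat (section_space.dim V) else \<infinity>)"

end

theory Submission
  imports Defs
begin

text \<open>The column of \<open>f\<close> with parameter \<open>a\<close> is the functional \<open>g \<mapsto> (f g)\<^sup>(\<^sup>a\<^sup>)\<close> on jets. Hence the upper triangular
  matrices \<open>T(f)\<close> with columns \<open>a = 0, \<dots>, d - 1\<close> satisfy \<open>T(f g) = T(f) T(g)\<close> by the Leibniz rule, and
  \<open>det T(f) = f\<^sup>d\<close>. Let \<open>x\<^sub>t = X\<^sub>t / X\<^sub>i\<close> in the chart \<open>U\<^sub>i\<close>. Passing to \<open>U\<^sub>j\<close> multiplies every matrix \<open>T(x\<^sub>t)\<close> by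
  \<open>T(X\<^sub>i / X\<^sub>j)\<close>, so each \<open>d \<times> d\<close> minor of the block matrix \<open>(T(x\<^sub>N) \<dots> T(x\<^sub>0))\<close> is a section twisted by
  \<open>\<O>(d)\<close>. On \<open>U\<^sub>0\<close> one has \<open>T(x\<^sub>0) = 1\<close>, and the minor that
  completes the columns of \<open>\<Delta>\<^sub>0(\<alpha>)\<close> by the last unit vectors is \<open>det \<Delta>\<^sub>0(\<alpha>)\<close>.

  For independence, give \<open>x\<^sub>t\<^sup>(\<^sup>a\<^sup>)\<close> the weight \<open>2 d t a - a\<^sup>2\<close>. By the rearrangement inequality the product of
  the diagonal entries is the unique monomial of largest weight in \<open>det \<Delta>\<^sub>0(\<alpha>)\<close>, and it determines \<open>\<alpha>\<close>
  because the pairs \<open>(t, a - c)\<close> along the diagonal are sorted.\<close>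

section \<open>Substitution and coefficients of jet polynomials\<close>

abbreviation jmonom :: "(jvar \<Rightarrow> 'b::comm_ring_1) \<Rightarrow> (jvar \<Rightarrow>\<^sub>0 nat) \<Rightarrow> 'b" where
  "jmonom \<sigma> m \<equiv> \<Prod>v\<in>Poly_Mapping.keys m. \<sigma> v ^ Poly_Mapping.lookup m v"

lemma poly_mapping_sum_single:
  "p = (\<Sum>m\<in>Poly_Mapping.keys p. Poly_Mapping.single m (Poly_Mapping.lookup p m))"
  by (rule poly_mapping_eqI)
    (auto simp: lookup_sum lookup_single when_def sum.delta' in_keys_iff cong: if_cong)

text \<open>Tailored to additive statements: the two summands may share exponents, so the second
  case is closed by additivity alone.\<close>

lemma poly_mapping_induct [case_names single add]:
  fixes p :: "'a \<Rightarrow>\<^sub>0 'b::comm_monoid_add"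
  assumes single: "\<And>m c. P (Poly_Mapping.single m c)"
    and add: "\<And>p q. P p \<Longrightarrow> P q \<Longrightarrow> P (p + q)"
  shows "P p"
proof -
  have "P (\<Sum>m\<in>K. Poly_Mapping.single m (f m))" if "finite K" for K and f :: "'a \<Rightarrow> 'b"
    \<comment> \<open>The empty sum is the term with coefficient 0, which \<open>single\<close>
      covers.\<close>
    using that by induction (use single[of _ 0] in \<open>auto intro: single add\<close>)
  then show ?thesis
    using poly_mapping_sum_single[of p] finite_keys by metis
qed

text \<open>Exponents outside the support contribute the factor 1, so several monomials can be
  expanded over one index set.\<close>

lemma jmonom_superset:
  assumes "finite K" "Poly_Mapping.keys m \<subseteq> K"
  shows "jmonom \<sigma> m = (\<Prod>v\<in>K. \<sigma> v ^ Poly_Mapping.lookup m v)"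
  by (rule prod.mono_neutral_left) (use assms in \<open>auto simp: in_keys_iff\<close>)

lemma jmonom_add: "jmonom \<sigma> (m + n) = jmonom \<sigma> m * jmonom \<sigma> n"
proof -
  let ?K = "Poly_Mapping.keys m \<union> Poly_Mapping.keys n"
  have "jmonom \<sigma> (m + n) = (\<Prod>v\<in>?K. \<sigma> v ^ Poly_Mapping.lookup (m + n) v)"
    by (rule jmonom_superset) (auto dest: subsetD[OF keys_add])
  also have "\<dots> = (\<Prod>v\<in>?K. \<sigma> v ^ Poly_Mapping.lookup m v) * (\<Prod>v\<in>?K. \<sigma> v ^ Poly_Mapping.lookup n v)"
    by (simp add: lookup_add power_add prod.distrib)
  also have "\<dots> = jmonom \<sigma> m * jmonom \<sigma> n"
    by (subst (1 2) jmonom_superset[of ?K]) auto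
  finally show ?thesis .
qed

lemma jmonom_Var: "jmonom Var m = Poly_Mapping.single m (1 :: 'a::comm_ring_1)"
proof -
  have pow: "(Var v :: 'a jpoly) ^ n = Poly_Mapping.single (Poly_Mapping.single v n) 1" for v n
    by (induction n) (auto simp: Var_def mult_single single_add[symmetric])
  have "(\<Prod>v\<in>K. (Var v :: 'a jpoly) ^ f v) = Poly_Mapping.single (\<Sum>v\<in>K. Poly_Mapping.single v (f v)) 1"
    if "finite K" for K f
    using that by induction (auto simp: pow mult_single)
  then show ?thesis
    by (simp add: poly_mapping_sum_single[of m, symmetric])
qed

lemma jsubst_superset:
  assumes "\<phi> 0 = 0" "finite K" "Poly_Mapping.keys p \<subseteq> K"
  shows "jsubst \<phi> \<sigma> p = (\<Sum>m\<in>K. \<phi> (Poly_Mapping.lookup p m) * jmonom \<sigma> m)"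
  unfolding jsubst_def
  by (rule sum.mono_neutral_left) (use assms in \<open>auto simp: in_keys_iff\<close>)

lemma jsubst_single:
  assumes "\<phi> 0 = 0"
  shows "jsubst \<phi> \<sigma> (Poly_Mapping.single m c) = \<phi> c * jmonom \<sigma> m"
  by (subst jsubst_superset[of _ "{m}"]) (use assms in \<open>auto split: if_splits\<close>)

lemma comm_ring_homI:
  assumes "\<And>x y. h (x + y) = h x + h y" "\<And>x y. h (x * y) = h x * h y" "h 1 = 1"
  shows "comm_ring_hom h"
proof -
  have "h 0 = 0" using assms(1)[of 0 0] by simp
  then show ?thesis using assms by unfold_locales auto
qed

text \<open>This is the universal property of the polynomial ring. Sums are compared over the union
  of the supports; products reduce by additivity to two single terms, where
  \<open>jmonom_add\<close> applies.\<close>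

lemma comm_ring_hom_jsubst:
  assumes "comm_ring_hom \<phi>"
  shows "comm_ring_hom (jsubst \<phi> \<sigma>)"
proof -
  interpret \<phi>: comm_ring_hom \<phi> by fact
  have add: "jsubst \<phi> \<sigma> (p + q) = jsubst \<phi> \<sigma> p + jsubst \<phi> \<sigma> q" for p q
  proof -
    let ?K = "Poly_Mapping.keys p \<union> Poly_Mapping.keys q"
    have "jsubst \<phi> \<sigma> (p + q) = (\<Sum>m\<in>?K. \<phi> (Poly_Mapping.lookup (p + q) m) * jmonom \<sigma> m)"
      by (rule jsubst_superset) (auto dest: subsetD[OF keys_add])
    also have "\<dots> = (\<Sum>m\<in>?K. \<phi> (Poly_Mapping.lookup p m) * jmonom \<sigma> m) +
        (\<Sum>m\<in>?K. \<phi> (Poly_Mapping.lookup q m) * jmonom \<sigma> m)"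
      by (simp add: lookup_add \<phi>.hom_add distrib_right sum.distrib)
    also have "\<dots> = jsubst \<phi> \<sigma> p + jsubst \<phi> \<sigma> q"
      by (subst (1 2) jsubst_superset[of _ ?K]) auto
    finally show ?thesis .
  qed
  have "jsubst \<phi> \<sigma> (p * q) = jsubst \<phi> \<sigma> p * jsubst \<phi> \<sigma> q" for p q
  proof (induction p rule: poly_mapping_induct)
    case (single m c)
    show ?case
      by (induction q rule: poly_mapping_induct)
        (auto simp: mult_single jsubst_single \<phi>.hom_mult jmonom_add add algebra_simps)
  qed (auto simp: distrib_right add)
  moreover have "jsubst \<phi> \<sigma> 1 = 1"
    using jsubst_single[of \<phi> \<sigma> 0 1] by simp
  ultimately show ?thesis
    using add by (intro comm_ring_homI)
qed

lemma jsubst_Cst: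
  assumes "comm_ring_hom \<phi>"
  shows "jsubst \<phi> \<sigma> (Cst c) = \<phi> c"
proof -
  interpret comm_ring_hom \<phi> by fact
  show ?thesis by (simp add: Cst_def jsubst_single)
qed

lemma jsubst_Var:
  assumes "comm_ring_hom \<phi>"
  shows "jsubst \<phi> \<sigma> (Var v) = \<sigma> v"
proof -
  interpret comm_ring_hom \<phi> by fact
  show ?thesis by (simp add: Var_def jsubst_single)
qed

section \<open>Evaluation of the coefficients at a point\<close>

text \<open>Coefficients may have junk values off the overlap, so identities between jet polynomials
  are stated after evaluation at a point; the jet variables stay formal.\<close>

definition eval_coeffs :: "point \<Rightarrow> (point \<Rightarrow> complex) jpoly \<Rightarrow> complex jpoly" where
  "eval_coeffs x = jsubst (\<lambda>f. Cst (f x)) Var"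

lemma comm_ring_hom_Cst_comp:
  assumes "comm_ring_hom h"
  shows "comm_ring_hom (\<lambda>f. Cst (h f))"
proof -
  interpret comm_ring_hom h by fact
  show ?thesis
    by (rule comm_ring_homI) (simp_all add: hom_distribs Cst_add Cst_mult Cst_one)
qed

lemma comm_ring_hom_at: "comm_ring_hom (\<lambda>f. f x)"
  by (rule comm_ring_homI) auto

interpretation eval_coeffs: comm_ring_hom "eval_coeffs x" for x
  unfolding eval_coeffs_def
  by (intro comm_ring_hom_jsubst comm_ring_hom_Cst_comp comm_ring_hom_at)

lemma lookup_eval_coeffs: "Poly_Mapping.lookup (eval_coeffs x p) m = Poly_Mapping.lookup p m x"
proof (induction p rule: poly_mapping_induct)
  case (single n c)
  have "eval_coeffs x (Poly_Mapping.single n c) = Poly_Mapping.single n (c x)"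
    unfolding eval_coeffs_def
    by (subst jsubst_single) (auto simp: jmonom_Var Cst_def mult_single)
  then show ?case by (simp add: lookup_single when_def)
qed (simp add: eval_coeffs.hom_add lookup_add)

lemma eval_coeffs_Cst [simp]: "eval_coeffs x (Cst f) = Cst (f x)"
  unfolding eval_coeffs_def by (rule jsubst_Cst) (intro comm_ring_hom_Cst_comp comm_ring_hom_at)

lemma eval_coeffs_Var [simp]: "eval_coeffs x (Var v) = Var v"
  unfolding eval_coeffs_def by (rule jsubst_Var) (intro comm_ring_hom_Cst_comp comm_ring_hom_at)

lemma eval_coeffs_single:
  "eval_coeffs x (Poly_Mapping.single m c) = Poly_Mapping.single m (c x)"
  by (rule poly_mapping_eqI) (simp add: lookup_eval_coeffs lookup_single when_def)

lemma lookup_restrict_coeffs: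
  "Poly_Mapping.lookup (restrict_coeffs V p) m x = (if x \<in> V then Poly_Mapping.lookup p m x else 0)"
  by (auto simp: restrict_coeffs_def map.rep_eq when_def)

lemma eval_restrict_coeffs: "x \<in> V \<Longrightarrow> eval_coeffs x (restrict_coeffs V p) = eval_coeffs x p"
  by (rule poly_mapping_eqI) (simp add: lookup_eval_coeffs lookup_restrict_coeffs)


section \<open>Subrings and polynomials with coefficients in them\<close>

text \<open>Kept as a predicate on sets because it serves for regular functions, for holomorphic
  functions and for the polynomials over either.\<close>

definition subring_closed :: "'a::comm_ring_1 set \<Rightarrow> bool" where
  "subring_closed R \<longleftrightarrow>
     1 \<in> R \<and> (\<forall>a\<in>R. - a \<in> R) \<and> (\<forall>a\<in>R. \<forall>b\<in>R. a + b \<in> R \<and> a * b \<in> R)"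

lemma subring_closedD:
  assumes "subring_closed R"
  shows "0 \<in> R" "1 \<in> R" "a \<in> R \<Longrightarrow> - a \<in> R"
    "a \<in> R \<Longrightarrow> b \<in> R \<Longrightarrow> a + b \<in> R" "a \<in> R \<Longrightarrow> b \<in> R \<Longrightarrow> a * b \<in> R"
proof -
  show 1: "1 \<in> R" "a \<in> R \<Longrightarrow> - a \<in> R"
    "a \<in> R \<Longrightarrow> b \<in> R \<Longrightarrow> a + b \<in> R" "a \<in> R \<Longrightarrow> b \<in> R \<Longrightarrow> a * b \<in> R" for a b
    using assms by (auto simp: subring_closed_def)
  show "0 \<in> R" using 1(3)[OF 1(1) 1(2)[OF 1(1)]] by simp
qed

lemma subring_closed_sum:
  assumes "subring_closed R" "\<And>i. i \<in> I \<Longrightarrow> f i \<in> R"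
  shows "sum f I \<in> R"
  using assms(2) by (induction I rule: infinite_finite_induct) (auto intro: subring_closedD[OF assms(1)])

lemma subring_closed_prod:
  assumes "subring_closed R" "\<And>i. i \<in> I \<Longrightarrow> f i \<in> R"
  shows "prod f I \<in> R"
  using assms(2) by (induction I rule: infinite_finite_induct) (auto intro: subring_closedD[OF assms(1)])

lemma subring_closed_of_nat: "subring_closed R \<Longrightarrow> of_nat n \<in> R"
  by (induction n) (auto intro: subring_closedD)

text \<open>By the permutation expansion, the determinant is an integer polynomial in the
  entries.\<close>

lemma subring_closed_det:
  assumes "subring_closed R" "A \<in> carrier_mat n n" "\<And>i j. i < n \<Longrightarrow> j < n \<Longrightarrow> A $$ (i, j) \<in> R"
  shows "Determinant.det A \<in> R"
proof -
  note R = subring_closedD[OF assms(1)]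
  show ?thesis
    unfolding det_def'[OF assms(2)]
    by (intro subring_closed_sum R subring_closed_prod assms)
      (auto simp: sign_def intro: R dest: permutes_in_image)
qed

text \<open>The coefficient condition ranges over all exponents, those off the support included, so
  it can be used without a case split; it forces 0 into \<open>C\<close>.\<close>

definition jpoly_over :: "jvar set \<Rightarrow> 'a::comm_ring_1 set \<Rightarrow> 'a jpoly set" where
  "jpoly_over V C = {p. \<forall>m. Poly_Mapping.lookup p m \<in> C \<and>
      (m \<in> Poly_Mapping.keys p \<longrightarrow> Poly_Mapping.keys m \<subseteq> V)}"

lemma single_in_jpoly_over:
  assumes "subring_closed C" "c \<in> C" "c \<noteq> 0 \<Longrightarrow> Poly_Mapping.keys m \<subseteq> V"
  shows "Poly_Mapping.single m c \<in> jpoly_over V C"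
  using assms by (auto simp: jpoly_over_def lookup_single when_def subring_closedD split: if_splits)

lemma jpoly_over_add:
  assumes "subring_closed C" "p \<in> jpoly_over V C" "q \<in> jpoly_over V C"
  shows "p + q \<in> jpoly_over V C"
proof -
  have "m \<in> Poly_Mapping.keys p \<or> m \<in> Poly_Mapping.keys q" if "m \<in> Poly_Mapping.keys (p + q)" for m
    using that keys_add[of p q] by auto
  then show ?thesis
    using assms(2,3) by (auto simp: jpoly_over_def lookup_add intro: subring_closedD(4)[OF assms(1)])
qed

text \<open>A product expands into single terms whose exponents are sums of two exponents supported
  in \<open>V\<close> and whose coefficients are products in \<open>C\<close>.\<close>

lemma subring_closed_jpoly_over:
  assumes C: "subring_closed C"
  shows "subring_closed (jpoly_over V C)"
proof -
  let ?S = "jpoly_over V C"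
  have sum: "sum f K \<in> ?S" if "\<And>i. i \<in> K \<Longrightarrow> f i \<in> ?S" for f :: "_ \<Rightarrow> 'a jpoly" and K :: "(jvar \<Rightarrow>\<^sub>0 nat) set"
    using that
  proof (induction K rule: infinite_finite_induct)
    case (insert i K)
    then show ?case using jpoly_over_add[OF C] by simp
  qed (auto simp: jpoly_over_def subring_closedD[OF C])
  have mult: "p * q \<in> ?S" if "p \<in> ?S" "q \<in> ?S" for p q
  proof -
    have "p * q = (\<Sum>m\<in>Poly_Mapping.keys p. \<Sum>n\<in>Poly_Mapping.keys q.
        Poly_Mapping.single (m + n) (Poly_Mapping.lookup p m * Poly_Mapping.lookup q n))"
      by (subst poly_mapping_sum_single[of p], subst poly_mapping_sum_single[of q])
        (simp add: sum_product mult_single)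
    also have "\<dots> \<in> ?S"
    proof (intro sum single_in_jpoly_over C)
      fix m n assume mn: "m \<in> Poly_Mapping.keys p" "n \<in> Poly_Mapping.keys q"
      show "Poly_Mapping.lookup p m * Poly_Mapping.lookup q n \<in> C"
        using that by (auto simp: jpoly_over_def intro: subring_closedD[OF C])
      show "Poly_Mapping.keys (m + n) \<subseteq> V"
        using that mn by (intro subset_trans[OF keys_add]) (auto simp: jpoly_over_def)
    qed
    finally show ?thesis .
  qed
  have "1 \<in> ?S"
    using single_in_jpoly_over[OF C, of 1 0 V] by (simp add: subring_closedD[OF C])
  moreover have "- p \<in> ?S" if "p \<in> ?S" for p
    using that by (auto simp: jpoly_over_def intro: subring_closedD[OF C])
  ultimately show ?thesis
    unfolding subring_closed_def using mult jpoly_over_add[OF C] by blast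
qed

lemma Cst_in_jpoly_over: "subring_closed C \<Longrightarrow> c \<in> C \<Longrightarrow> Cst c \<in> jpoly_over V C"
  unfolding Cst_def by (rule single_in_jpoly_over) auto

lemma Var_in_jpoly_over: "subring_closed C \<Longrightarrow> v \<in> V \<Longrightarrow> Var v \<in> jpoly_over V C"
  unfolding Var_def by (rule single_in_jpoly_over) (auto intro: subring_closedD)

text \<open>The second case keeps the membership of both summands because additivity of formal
  differentiation is available for regular coefficients.\<close>

lemma jpoly_over_induct [consumes 1, case_names single add]:
  assumes "p \<in> jpoly_over V C"
    and single: "\<And>m c. Poly_Mapping.single m c \<in> jpoly_over V C \<Longrightarrow> c \<in> C \<Longrightarrow> P (Poly_Mapping.single m c)"
    and add: "\<And>p q. p \<in> jpoly_over V C \<Longrightarrow> q \<in> jpoly_over V C \<Longrightarrow> P p \<Longrightarrow> P q \<Longrightarrow> P (p + q)"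
    and C: "subring_closed C"
  shows "P p"
proof -
  let ?f = "\<lambda>m. Poly_Mapping.single m (Poly_Mapping.lookup p m)"
  have f: "?f m \<in> jpoly_over V C" "Poly_Mapping.lookup p m \<in> C" for m
    using assms(1) single_in_jpoly_over[OF C, of "Poly_Mapping.lookup p m" m V]
    by (auto simp: jpoly_over_def in_keys_iff)
  have "sum ?f K \<in> jpoly_over V C \<and> P (sum ?f K)" if "finite K" for K
    using that
  proof induction
    case empty
    have "0 \<in> jpoly_over V C"
      by (rule subring_closedD[OF subring_closed_jpoly_over[OF C]])
    then show ?case
      using single[of 0 0] subring_closedD(1)[OF C] by simp
  next
    case (insert m K)
    then show ?case
      using f add single jpoly_over_add[OF C] by simp
  qed
  then show ?thesis
    using poly_mapping_sum_single[of p] finite_keys by metis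
qed


section \<open>Formal differentiation on an overlap\<close>

text \<open>A class of coefficients that is closed under iterated partial derivatives, on which no further
  smoothness argument is needed. Closure under agreement on the overlap absorbs the junk values of
  \<open>partial_deriv\<close> elsewhere.\<close>

inductive_set regular_on_overlap :: "nat \<Rightarrow> nat \<Rightarrow> nat \<Rightarrow> (point \<Rightarrow> complex) set" for N i j where
  const: "(\<lambda>x. c) \<in> regular_on_overlap N i j"
| coord: "(\<lambda>x. x t) \<in> regular_on_overlap N i j"
| inverse: "(\<lambda>x. inverse (x j)) \<in> regular_on_overlap N i j"
| add: "f \<in> regular_on_overlap N i j \<Longrightarrow> g \<in> regular_on_overlap N i j \<Longrightarrow>
    f + g \<in> regular_on_overlap N i j"
| mult: "f \<in> regular_on_overlap N i j \<Longrightarrow> g \<in> regular_on_overlap N i j \<Longrightarrow>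
    f * g \<in> regular_on_overlap N i j"
| cong: "f \<in> regular_on_overlap N i j \<Longrightarrow> (\<And>x. x \<in> overlap N i j \<Longrightarrow> g x = f x) \<Longrightarrow>
    g \<in> regular_on_overlap N i j"

lemma subring_closed_regular: "subring_closed (regular_on_overlap N i j)"
proof -
  have "- f \<in> regular_on_overlap N i j" if "f \<in> regular_on_overlap N i j" for f
    using regular_on_overlap.mult[OF regular_on_overlap.const[of "- 1"] that]
    by (simp add: fun_Compl_def times_fun_def)
  moreover have "1 \<in> regular_on_overlap N i j"
    using regular_on_overlap.const[of 1] by (simp add: one_fun_def)
  ultimately show ?thesis
    by (auto simp: subring_closed_def intro: regular_on_overlap.add regular_on_overlap.mult)
qed

text \<open>The overlap is not open in \<open>nat \<Rightarrow> complex\<close>, so openness is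
  stated one coordinate at a time. A point can leave it along a slice only through
  \<open>x j\<close> becoming 0.\<close>

lemma eventually_slice_overlap:
  assumes "x \<in> overlap N i j" "t \<in> coords N i"
  shows "\<forall>\<^sub>F z in nhds (x t). x(t := z) \<in> overlap N i j"
proof (cases "t = j")
  case True
  have "\<forall>\<^sub>F z in nhds (x t). z \<in> - {0}"
    using assms True by (intro eventually_nhds_in_open) (auto simp: overlap_def)
  then show ?thesis
    by eventually_elim (use assms True in \<open>auto simp: overlap_def chart_def coords_def\<close>)
next
  case False
  then show ?thesis
    using assms by (auto simp: overlap_def chart_def coords_def)
qed

lemma slice_cong:
  assumes "\<And>x. x \<in> overlap N i j \<Longrightarrow> f x = g x" "x \<in> overlap N i j" "t \<in> coords N i"
  shows "\<forall>\<^sub>F z in nhds (x t). f (x(t := z)) = g (x(t := z))"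
  using eventually_slice_overlap[OF assms(2,3)] by eventually_elim (rule assms(1))

lemma partial_deriv_cong:
  assumes "\<And>x. x \<in> overlap N i j \<Longrightarrow> f x = g x" "x \<in> overlap N i j" "t \<in> coords N i"
  shows "partial_deriv t f x = partial_deriv t g x"
  unfolding partial_deriv_def using slice_cong[OF assms] by (intro deriv_cong_ev) auto

lemma regular_differentiable:
  assumes "f \<in> regular_on_overlap N i j" "x \<in> overlap N i j" "t \<in> coords N i"
  shows "(\<lambda>z. f (x(t := z))) field_differentiable at (x t)"
  using assms(1)
proof induction
  case (coord s)
  show ?case by (cases "s = t") auto
next
  case inverse
  show ?case
    using assms(2) by (cases "j = t") (auto intro!: field_differentiable_inverse simp: overlap_def)
next
  case (add f g)
  then show ?case by (auto intro: field_differentiable_add)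
next
  case (mult f g)
  then show ?case by (auto intro: field_differentiable_mult)
next
  case (cong f g)
  show ?case
    \<comment> \<open>The two functions agree near \<open>x t\<close> along the slice, so
      differentiability passes from one to the other.\<close>
    using cong.IH DERIV_cong_ev[OF refl slice_cong[of N i j g f x t, OF cong.hyps(2) assms(2,3)] refl]
    unfolding field_differentiable_def by blast
qed auto

lemma partial_deriv_add:
  assumes "f \<in> regular_on_overlap N i j" "g \<in> regular_on_overlap N i j"
    "x \<in> overlap N i j" "t \<in> coords N i"
  shows "partial_deriv t (f + g) x = partial_deriv t f x + partial_deriv t g x"
  using regular_differentiable[OF assms(1,3,4)] regular_differentiable[OF assms(2-4)]
  by (simp add: partial_deriv_def)

lemma partial_deriv_mult:
  assumes "f \<in> regular_on_overlap N i j" "g \<in> regular_on_overlap N i j"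
    "x \<in> overlap N i j" "t \<in> coords N i"
  shows "partial_deriv t (f * g) x = f x * partial_deriv t g x + partial_deriv t f x * g x"
  using regular_differentiable[OF assms(1,3,4)] regular_differentiable[OF assms(2-4)]
  by (simp add: partial_deriv_def)

lemma partial_deriv_const [simp]: "partial_deriv t (\<lambda>x. c) = (\<lambda>x. 0)"
  by (simp add: partial_deriv_def fun_eq_iff)

lemma partial_deriv_zero [simp]: "partial_deriv t 0 = 0"
  by (simp add: partial_deriv_def fun_eq_iff)

lemma partial_deriv_coord: "partial_deriv t (\<lambda>x. x s) = (\<lambda>x. if s = t then 1 else 0)"
  by (auto simp: partial_deriv_def fun_eq_iff)

lemma partial_deriv_inverse:
  "x j \<noteq> 0 \<Longrightarrow> partial_deriv t (\<lambda>x. inverse (x j)) x = (if t = j then - (inverse (x j) * inverse (x j)) else 0)"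
proof (cases "t = j")
  case True
  assume "x j \<noteq> 0"
  then have "((\<lambda>z. inverse z) has_field_derivative - (inverse (x j) * 1 * inverse (x j))) (at (x j))"
    by (rule DERIV_inverse'[OF DERIV_ident])
  then show ?thesis
    using True by (auto simp: partial_deriv_def intro: DERIV_imp_deriv)
qed (auto simp: partial_deriv_def)

text \<open>The rules for inverse, sum and product are used at points of the overlap only, so these
  cases pass through \<open>regular_on_overlap.cong\<close>.\<close>

lemma partial_deriv_regular:
  assumes "f \<in> regular_on_overlap N i j" "t \<in> coords N i"
  shows "partial_deriv t f \<in> regular_on_overlap N i j"
  using assms(1)
proof induction
  case (coord s)
  show ?case unfolding partial_deriv_coord by (rule regular_on_overlap.const)
next
  case inverse
  have inv: "(\<lambda>x. inverse (x j)) \<in> regular_on_overlap N i j"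
    by (rule regular_on_overlap.inverse)
  show ?case
  proof (rule regular_on_overlap.cong)
    show "(\<lambda>x. if t = j then - 1 else 0) * ((\<lambda>x. inverse (x j)) * (\<lambda>x. inverse (x j)))
      \<in> regular_on_overlap N i j"
      by (intro regular_on_overlap.mult inv regular_on_overlap.const)
  qed (auto simp: partial_deriv_inverse overlap_def)
next
  case (add f g)
  show ?case
    by (rule regular_on_overlap.cong[OF regular_on_overlap.add[OF add.IH]])
      (subst partial_deriv_add[OF add.hyps], assumption, rule assms, simp)
next
  case (mult f g)
  show ?case
    by (rule regular_on_overlap.cong[OF regular_on_overlap.add[OF
            regular_on_overlap.mult[OF mult.hyps(1) mult.IH(2)] regular_on_overlap.mult[OF mult.IH(1) mult.hyps(2)]]])
      (subst partial_deriv_mult[OF mult.hyps], assumption, rule assms, simp)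
next
  case (cong f g)
  show ?case
    by (rule regular_on_overlap.cong[OF cong.IH]) (rule partial_deriv_cong[OF cong.hyps(2) _ assms(2)])
qed (auto intro: regular_on_overlap.const)

section \<open>Formal differentiation evaluated at a point\<close>

text \<open>The part of formal differentiation that acts on the jet variables of a monomial; it
  depends neither on the point nor on the coefficient.\<close>

definition jshift :: "(jvar \<Rightarrow>\<^sub>0 nat) \<Rightarrow> complex jpoly" where
  "jshift m = (\<Sum>(t, l)\<in>Poly_Mapping.keys m. Poly_Mapping.single
     (m - Poly_Mapping.single (t, l) 1 + Poly_Mapping.single (t, Suc l) 1)
     (of_nat (Poly_Mapping.lookup m (t, l))))"

text \<open>The product rule for monomials: multiplicities of a variable add, and each share is
  attributed to its own factor.\<close>

lemma jshift_add:
  "jshift (m + n) = Poly_Mapping.single n 1 * jshift m + Poly_Mapping.single m 1 * jshift n"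
proof -
  let ?K = "Poly_Mapping.keys m \<union> Poly_Mapping.keys n"
  let ?s = "\<lambda>m v. Poly_Mapping.single (m - Poly_Mapping.single v 1 + Poly_Mapping.single (fst v, Suc (snd v)) 1)
     (of_nat (Poly_Mapping.lookup m v)) :: complex jpoly"
  have sup: "jshift k = sum (?s k) ?K" if "Poly_Mapping.keys k \<subseteq> ?K" for k
    unfolding jshift_def case_prod_unfold prod.collapse
    by (rule sum.mono_neutral_left) (use that in \<open>auto simp: in_keys_iff\<close>)
  \<comment> \<open>Subtraction of exponents is truncated, so it may be moved from
    \<open>k + n\<close> to \<open>k\<close> only when \<open>v\<close> occurs in \<open>k\<close>;
    otherwise both sides have coefficient 0.\<close>
  have half: "Poly_Mapping.single (k + n - Poly_Mapping.single v 1 + Poly_Mapping.single (fst v, Suc (snd v)) 1)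
      (of_nat (Poly_Mapping.lookup k v)) = Poly_Mapping.single n 1 * ?s k v" for k n v
  proof (cases "Poly_Mapping.lookup k v = 0")
    case False
    have "k + n - Poly_Mapping.single v 1 = n + (k - Poly_Mapping.single v 1)"
      by (rule poly_mapping_eqI) (use False in \<open>auto simp: lookup_add lookup_minus lookup_single when_def\<close>)
    then show ?thesis by (simp add: mult_single add_ac)
  qed simp
  have "?s (m + n) v = Poly_Mapping.single n 1 * ?s m v + Poly_Mapping.single m 1 * ?s n v" for v
    unfolding half[symmetric]
    by (simp add: lookup_add single_add add.commute)
  then have "jshift (m + n) = (\<Sum>v\<in>?K. Poly_Mapping.single n 1 * ?s m v + Poly_Mapping.single m 1 * ?s n v)"
    by (subst sup) (auto dest: subsetD[OF keys_add])
  then show ?thesis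
    by (simp add: sum.distrib sum_distrib_left sup)
qed

text \<open>The differential of \<open>c\<close> at \<open>x\<close>, as a linear form in the jet
  variables of order 1.\<close>

definition jgrad :: "nat \<Rightarrow> nat \<Rightarrow> point \<Rightarrow> (point \<Rightarrow> complex) \<Rightarrow> complex jpoly" where
  "jgrad N i x c = (\<Sum>t\<in>coords N i. Cst (partial_deriv t c x) * Var (t, 1))"

definition jderiv_term :: "nat \<Rightarrow> nat \<Rightarrow> point \<Rightarrow> (jvar \<Rightarrow>\<^sub>0 nat) \<Rightarrow> (point \<Rightarrow> complex) \<Rightarrow> complex jpoly" where
  "jderiv_term N i x m c = Poly_Mapping.single m 1 * jgrad N i x c + Cst (c x) * jshift m"

lemma jderiv_term_zero [simp]: "jderiv_term N i x m 0 = 0"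
  by (simp add: jderiv_term_def jgrad_def Cst_def)

lemma finite_coords [simp]: "finite (coords N i)"
  by (simp add: coords_def)

text \<open>Zero coefficients contribute 0, so two polynomials can be differentiated over a common
  index set.\<close>

lemma eval_total_deriv:
  assumes "finite K" "Poly_Mapping.keys p \<subseteq> K"
  shows "eval_coeffs x (total_deriv N i p) = (\<Sum>m\<in>K. jderiv_term N i x m (Poly_Mapping.lookup p m))"
proof -
  have "eval_coeffs x (total_deriv N i p) = (\<Sum>m\<in>Poly_Mapping.keys p. jderiv_term N i x m (Poly_Mapping.lookup p m))"
    unfolding total_deriv_def jderiv_term_def jgrad_def jshift_def
    by (simp add: eval_coeffs.hom_sum eval_coeffs.hom_add eval_coeffs_single case_prod_unfold
        sum_distrib_left Cst_def Var_def mult_single mult.commute)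
  also have "\<dots> = (\<Sum>m\<in>K. jderiv_term N i x m (Poly_Mapping.lookup p m))"
    by (rule sum.mono_neutral_left) (use assms in \<open>auto simp: in_keys_iff\<close>)
  finally show ?thesis .
qed

lemma eval_total_deriv_single:
  "eval_coeffs x (total_deriv N i (Poly_Mapping.single m c)) = jderiv_term N i x m c"
  by (subst eval_total_deriv[of "{m}"]) (auto split: if_splits)

text \<open>Equality is assumed throughout the overlap because the derivative at \<open>x\<close>
  sees the coefficients along slices, which stay in the overlap near \<open>x\<close>.\<close>

lemma eval_total_deriv_cong:
  assumes eq: "\<And>y. y \<in> overlap N i j \<Longrightarrow> eval_coeffs y p = eval_coeffs y q" and x: "x \<in> overlap N i j"
  shows "eval_coeffs x (total_deriv N i p) = eval_coeffs x (total_deriv N i q)"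
proof -
  let ?K = "Poly_Mapping.keys p \<union> Poly_Mapping.keys q"
  have lk: "Poly_Mapping.lookup p m y = Poly_Mapping.lookup q m y" if "y \<in> overlap N i j" for m y
    using eq[OF that] by (metis lookup_eval_coeffs)
  have "jderiv_term N i x m (Poly_Mapping.lookup p m) = jderiv_term N i x m (Poly_Mapping.lookup q m)" for m
  proof -
    have "partial_deriv t (Poly_Mapping.lookup p m) x = partial_deriv t (Poly_Mapping.lookup q m) x"
      if "t \<in> coords N i" for t
      using lk x that by (intro partial_deriv_cong) auto
    then show ?thesis
      unfolding jderiv_term_def jgrad_def using lk[OF x] by simp
  qed
  then show ?thesis
    by (subst (1 2) eval_total_deriv[of ?K]) auto
qed

abbreviation regular_jpolys :: "nat \<Rightarrow> nat \<Rightarrow> nat \<Rightarrow> (point \<Rightarrow> complex) jpoly set" where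
  "regular_jpolys N i j \<equiv> jpoly_over UNIV (regular_on_overlap N i j)"

lemmas subring_closed_regular_jpolys = subring_closed_jpoly_over[OF subring_closed_regular]

lemma total_deriv_regular:
  assumes "p \<in> regular_jpolys N i j"
  shows "total_deriv N i p \<in> regular_jpolys N i j"
proof -
  have lk: "Poly_Mapping.lookup p m \<in> regular_on_overlap N i j" for m
    using assms by (simp add: jpoly_over_def)
  show ?thesis
    unfolding total_deriv_def case_prod_unfold
    by (intro subring_closed_sum subring_closed_regular_jpolys
        subring_closedD(4)[OF subring_closed_regular_jpolys] single_in_jpoly_over
        subring_closed_regular partial_deriv_regular lk subring_closedD(5)[OF subring_closed_regular]
        subring_closed_of_nat) auto
qed

text \<open>\<open>total_deriv\<close> is built on \<open>deriv\<close>, which is additive only for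
  differentiable functions; hence the regular coefficients and the evaluation at a point of the
  overlap.\<close>

lemma eval_total_deriv_add:
  assumes "p \<in> regular_jpolys N i j" "q \<in> regular_jpolys N i j" "x \<in> overlap N i j"
  shows "eval_coeffs x (total_deriv N i (p + q)) =
    eval_coeffs x (total_deriv N i p) + eval_coeffs x (total_deriv N i q)"
proof -
  let ?K = "Poly_Mapping.keys p \<union> Poly_Mapping.keys q"
  have grad: "jgrad N i x (Poly_Mapping.lookup p m + Poly_Mapping.lookup q m) =
      jgrad N i x (Poly_Mapping.lookup p m) + jgrad N i x (Poly_Mapping.lookup q m)" for m
    unfolding jgrad_def sum.distrib[symmetric]
    using assms partial_deriv_add[of _ N i j _ x]
    by (intro sum.cong) (auto simp: jpoly_over_def Cst_add distrib_right)
  have "eval_coeffs x (total_deriv N i (p + q)) = (\<Sum>m\<in>?K. jderiv_term N i x m (Poly_Mapping.lookup (p + q) m))"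
    by (rule eval_total_deriv) (auto dest: subsetD[OF keys_add])
  also have "\<dots> = (\<Sum>m\<in>?K. jderiv_term N i x m (Poly_Mapping.lookup p m)) +
      (\<Sum>m\<in>?K. jderiv_term N i x m (Poly_Mapping.lookup q m))"
    by (simp add: jderiv_term_def lookup_add grad Cst_add algebra_simps sum.distrib)
  also have "\<dots> = eval_coeffs x (total_deriv N i p) + eval_coeffs x (total_deriv N i q)"
    by (subst (1 2) eval_total_deriv[of ?K]) auto
  finally show ?thesis .
qed

text \<open>Both sides are additive in each factor, so two single terms suffice. There the product
  rule for coefficients combines with \<open>jshift_add\<close>.\<close>

lemma eval_total_deriv_mult:
  assumes "p \<in> regular_jpolys N i j" "q \<in> regular_jpolys N i j" "x \<in> overlap N i j"
  shows "eval_coeffs x (total_deriv N i (p * q)) =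
    eval_coeffs x (total_deriv N i p) * eval_coeffs x q + eval_coeffs x p * eval_coeffs x (total_deriv N i q)"
  using assms(1)
proof (induction rule: jpoly_over_induct)
  case (single m c)
  show ?case
    using assms(2)
  proof (induction rule: jpoly_over_induct)
    case (single n c')
    have "jgrad N i x (c * c') = Cst (c x) * jgrad N i x c' + Cst (c' x) * jgrad N i x c"
      unfolding jgrad_def sum_distrib_left sum.distrib[symmetric]
      using \<open>c \<in> _\<close> single assms partial_deriv_mult[of _ N i j _ x]
      by (intro sum.cong) (auto simp: Cst_add Cst_mult algebra_simps)
    moreover have "eval_coeffs x (Poly_Mapping.single k b) = Cst (b x) * Poly_Mapping.single k 1" for k b
      by (simp add: eval_coeffs_single Cst_def mult_single)
    moreover have "Poly_Mapping.single (m + n) 1 = Poly_Mapping.single m (1::complex) * Poly_Mapping.single n 1"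
      by (simp add: mult_single)
    moreover have "eval_coeffs x (total_deriv N i (Poly_Mapping.single m c * Poly_Mapping.single n c')) =
        jderiv_term N i x (m + n) (c * c')"
      by (simp only: mult_single eval_total_deriv_single)
    ultimately show ?case
      unfolding eval_total_deriv_single jderiv_term_def jshift_add
      by (simp only: times_fun_apply Cst_mult) (simp add: algebra_simps)
  next
    case (add q q')
    then show ?case
      using single assms(3) subring_closedD(5)[OF subring_closed_regular_jpolys]
      by (simp add: distrib_left eval_total_deriv_add[where j = j] eval_coeffs.hom_add algebra_simps)
  qed (rule subring_closed_regular)
next
  case (add p p')
  then show ?case
    using assms(2,3) subring_closedD(5)[OF subring_closed_regular_jpolys]
    by (simp add: distrib_right eval_total_deriv_add[where j = j] eval_coeffs.hom_add algebra_simps)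
qed (rule subring_closed_regular)

lemma eval_total_deriv_sum:
  assumes "\<And>r. r \<in> I \<Longrightarrow> f r \<in> regular_jpolys N i j" "x \<in> overlap N i j"
  shows "eval_coeffs x (total_deriv N i (sum f I)) = (\<Sum>r\<in>I. eval_coeffs x (total_deriv N i (f r)))"
  using assms(1)
proof (induction I rule: infinite_finite_induct)
  case (insert r I)
  then show ?case
    using eval_total_deriv_add[of "f r" N i j "sum f I", OF _ subring_closed_sum[OF subring_closed_regular_jpolys] assms(2)]
    by simp
qed (auto simp: eval_total_deriv[of "{}"])

text \<open>A natural multiple is a repeated sum, so additivity suffices.\<close>

lemma eval_total_deriv_of_nat_mult:
  assumes "p \<in> regular_jpolys N i j" "x \<in> overlap N i j"
  shows "eval_coeffs x (total_deriv N i (of_nat n * p)) = of_nat n * eval_coeffs x (total_deriv N i p)"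
  using eval_total_deriv_sum[of "{..<n}" "\<lambda>_. p", OF assms] by simp

text \<open>Pascal's rule in the form needed for the inductive step of the Leibniz formula,
  separated from differentiation.\<close>

lemma binomial_sum_Suc:
  fixes F G :: "nat \<Rightarrow> 'a::comm_ring_1"
  shows "(\<Sum>r\<le>n. of_nat (n choose r) * (F (Suc r) * G (n - r) + F r * G (Suc (n - r)))) =
    (\<Sum>r\<le>Suc n. of_nat (Suc n choose r) * (F r * G (Suc n - r)))"
proof -
  have "(\<Sum>r\<le>Suc n. of_nat (Suc n choose r) * (F r * G (Suc n - r))) =
      (\<Sum>r\<le>n. of_nat (n choose r) * (F (Suc r) * G (n - r))) +
      (F 0 * G (Suc n) + (\<Sum>r\<le>n. of_nat (n choose Suc r) * (F (Suc r) * G (n - r))))"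
    by (subst sum.atMost_Suc_shift) (simp add: sum.distrib algebra_simps)
  also have "F 0 * G (Suc n) + (\<Sum>r\<le>n. of_nat (n choose Suc r) * (F (Suc r) * G (n - r))) =
      (\<Sum>r\<le>Suc n. of_nat (n choose r) * (F r * G (Suc n - r)))"
    by (subst sum.atMost_Suc_shift) (simp add: binomial_eq_0)
  \<comment> \<open>The top term drops because \<open>n choose Suc n\<close> is 0.\<close>
  also have "\<dots> = (\<Sum>r\<le>n. of_nat (n choose r) * (F r * G (Suc (n - r))))"
    by (simp add: Suc_diff_le binomial_eq_0)
  finally show ?thesis
    by (simp add: distrib_left sum.distrib)
qed

lemma total_deriv_iter_regular:
  "p \<in> regular_jpolys N i j \<Longrightarrow> (total_deriv N i ^^ n) p \<in> regular_jpolys N i j"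
  by (induction n) (auto intro: total_deriv_regular)

text \<open>The point is generalised in the induction: each differentiation consumes equality on the
  whole overlap.\<close>

lemma total_deriv_iter_cong:
  assumes "\<And>y. y \<in> overlap N i j \<Longrightarrow> eval_coeffs y p = eval_coeffs y q" "x \<in> overlap N i j"
  shows "eval_coeffs x ((total_deriv N i ^^ n) p) = eval_coeffs x ((total_deriv N i ^^ n) q)"
  using assms(2) by (induction n arbitrary: x) (auto intro: assms(1) eval_total_deriv_cong)

lemma total_deriv_iter_Leibniz:
  assumes p: "p \<in> regular_jpolys N i j" and q: "q \<in> regular_jpolys N i j" and "x \<in> overlap N i j"
  shows "eval_coeffs x ((total_deriv N i ^^ n) (p * q)) =
    (\<Sum>r\<le>n. of_nat (n choose r) *
      (eval_coeffs x ((total_deriv N i ^^ r) p) * eval_coeffs x ((total_deriv N i ^^ (n - r)) q)))"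
  using assms(3)
proof (induction n arbitrary: x)
  case (Suc n)
  let ?D = "total_deriv N i"
  have mem: "(?D ^^ r) p * (?D ^^ s) q \<in> regular_jpolys N i j" for r s
    by (intro subring_closedD(5)[OF subring_closed_regular_jpolys] total_deriv_iter_regular p q)
  have of_nat_mem: "of_nat (n choose r) * ((?D ^^ r) p * (?D ^^ (n - r)) q) \<in> regular_jpolys N i j" for r
    by (intro subring_closedD(5)[OF subring_closed_regular_jpolys] mem
        subring_closed_of_nat[OF subring_closed_regular_jpolys])
  \<comment> \<open>The formula of order \<open>n\<close> holds at every point of the overlap, so
    the sum may replace the \<open>n\<close>-th derivative under one more \<open>?D\<close>.\<close>
  have "eval_coeffs x ((?D ^^ Suc n) (p * q)) =
      eval_coeffs x (?D (\<Sum>r\<le>n. of_nat (n choose r) * ((?D ^^ r) p * (?D ^^ (n - r)) q)))"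
    unfolding funpow.simps comp_def
    by (rule eval_total_deriv_cong[OF _ Suc.prems])
      (simp add: Suc.IH eval_coeffs.hom_sum eval_coeffs.hom_mult eval_coeffs.hom_of_nat)
  also have "\<dots> = (\<Sum>r\<le>n. of_nat (n choose r) *
      (eval_coeffs x ((?D ^^ Suc r) p) * eval_coeffs x ((?D ^^ (n - r)) q) +
       eval_coeffs x ((?D ^^ r) p) * eval_coeffs x ((?D ^^ Suc (n - r)) q)))"
    by (simp only: eval_total_deriv_sum[where f = "\<lambda>r. of_nat (n choose r) * ((?D ^^ r) p * (?D ^^ (n - r)) q)",
          OF of_nat_mem Suc.prems] eval_total_deriv_of_nat_mult[OF mem Suc.prems]
          eval_total_deriv_mult[OF total_deriv_iter_regular[OF p] total_deriv_iter_regular[OF q] Suc.prems]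
          funpow.simps comp_def)
  finally show ?case
    by (simp only: binomial_sum_Suc[of n "\<lambda>r. eval_coeffs x ((?D ^^ r) p)" "\<lambda>r. eval_coeffs x ((?D ^^ r) q)"])
qed (simp add: eval_coeffs.hom_mult)


section \<open>Determinants of jets as global sections\<close>

text \<open>The entries are left open as \<xi>, so that one matrix serves for formal variables, for
  jets in a chart and for transformed jets. The column of \<open>(t, a)\<close> lists the
  coefficients of the derivatives of \<open>g\<close> in the \<open>a\<close>-th derivative of the
  product of \<open>g\<close> with the function whose jets are \<open>\<xi> (t, _)\<close>.\<close>

definition jetmat :: "(jvar \<Rightarrow> 'a::comm_ring_1) \<Rightarrow> (nat \<times> nat) list \<Rightarrow> nat \<Rightarrow> 'a mat" where
  "jetmat \<xi> L n = mat n n (\<lambda>(r, c). case L ! c of (t, a) \<Rightarrow>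
     if r \<le> a then of_nat (a choose r) * \<xi> (t, a - r) else 0)"

lemma jetmat_carrier [simp]: "jetmat \<xi> L n \<in> carrier_mat n n"
  by (simp add: jetmat_def)

lemma dim_jetmat [simp]: "dim_row (jetmat \<xi> L n) = n" "dim_col (jetmat \<xi> L n) = n"
  by (simp_all add: jetmat_def)

lemma jetmat_index:
  "r < n \<Longrightarrow> c < n \<Longrightarrow> jetmat \<xi> L n $$ (r, c) =
    (if r \<le> snd (L ! c) then of_nat (snd (L ! c) choose r) * \<xi> (fst (L ! c), snd (L ! c) - r) else 0)"
  by (simp add: jetmat_def case_prod_unfold)

lemma hom_det_jetmat:
  assumes "comm_ring_hom h"
  shows "h (Determinant.det (jetmat \<xi> L n)) = Determinant.det (jetmat (\<lambda>v. h (\<xi> v)) L n)"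
proof -
  interpret comm_ring_hom h by fact
  have "map_mat h (jetmat \<xi> L n) = jetmat (\<lambda>v. h (\<xi> v)) L n"
    by (rule eq_matI) (auto simp: jetmat_index hom_distribs)
  then show ?thesis by (metis hom_det)
qed

lemma jetmat_cong:
  assumes "length L = n" "\<And>t a b. (t, a) \<in> set L \<Longrightarrow> b \<le> a \<Longrightarrow> \<xi> (t, b) = \<psi> (t, b)"
  shows "jetmat \<xi> L n = jetmat \<psi> L n"
proof (rule eq_matI)
  fix r c assume "r < dim_row (jetmat \<psi> L n)" "c < dim_col (jetmat \<psi> L n)"
  moreover from this have "L ! c \<in> set L" using assms(1) by simp
  ultimately show "jetmat \<xi> L n $$ (r, c) = jetmat \<psi> L n $$ (r, c)"
    using assms(2)[of "fst (L ! c)" "snd (L ! c)"] by (auto simp: jetmat_index)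
qed auto

lemma det_Delta0_jetmat:
  "det_Delta0 N \<alpha> = Determinant.det (jetmat Var (column_list N \<alpha>) (tail_length N \<alpha> 1))"
  by (simp add: det_Delta0_def Delta0_def jetmat_def column_entry_def)

text \<open>If \<open>\<xi>\<close>, \<open>\<zeta>\<close> and \<open>\<psi>\<close> are the jets of \<open>f g\<close>, \<open>f\<close> and \<open>g\<close>, then the matrix of \<open>f g\<close> is
  that of \<open>g\<close> multiplied from the left by the upper triangular matrix of \<open>f\<close>.\<close>

lemma det_jetmat_Leibniz:
  fixes \<xi> \<psi> :: "jvar \<Rightarrow> 'a::comm_ring_1"
  assumes len: "length L = n" and lt: "\<And>t a. (t, a) \<in> set L \<Longrightarrow> a < n"
    and Leibniz: "\<And>t a b. (t, a) \<in> set L \<Longrightarrow> b \<le> a \<Longrightarrow>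
      \<xi> (t, b) = (\<Sum>r\<le>b. of_nat (b choose r) * (\<zeta> r * \<psi> (t, b - r)))"
  shows "Determinant.det (jetmat \<xi> L n) = \<zeta> 0 ^ n * Determinant.det (jetmat \<psi> L n)"
proof -
  \<comment> \<open>This is \<open>T(f)\<close> of size \<open>n\<close>, with \<zeta> as the jets
    of \<open>f\<close>; its diagonal is constantly \<open>\<zeta> 0\<close>.\<close>
  define A where "A = mat n n (\<lambda>(r, q). if r \<le> q then of_nat (q choose r) * \<zeta> (q - r) else 0)"
  have A: "A \<in> carrier_mat n n" by (simp add: A_def)
  have "Determinant.det A = prod_list (diag_mat A)"
    by (rule det_upper_triangular[OF _ A]) (auto simp: A_def upper_triangular_def)
  also have "diag_mat A = replicate n (\<zeta> 0)"
    unfolding diag_mat_def by (auto simp: A_def list_eq_iff_nth_eq)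
  finally have detA: "Determinant.det A = \<zeta> 0 ^ n" by simp
  have "jetmat \<xi> L n = A * jetmat \<psi> L n"
  proof (rule eq_matI)
    fix r c assume "r < dim_row (A * jetmat \<psi> L n)" "c < dim_col (A * jetmat \<psi> L n)"
    then have rc: "r < n" "c < n" by (auto simp: A_def)
    obtain t a where ta: "L ! c = (t, a)" by force
    then have mem: "(t, a) \<in> set L" using rc len by (metis nth_mem)
    have an: "a < n" using lt mem .
    have "(A * jetmat \<psi> L n) $$ (r, c) =
        (\<Sum>q = 0..<n. A $$ (r, q) * jetmat \<psi> L n $$ (q, c))"
      using rc A by (simp add: scalar_prod_def)
    also have "\<dots> = (\<Sum>q = 0..<n. if q \<in> {r..a} then
        of_nat (q choose r) * \<zeta> (q - r) * (of_nat (a choose q) * \<psi> (t, a - q)) else 0)"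
      using rc by (intro sum.cong) (auto simp: A_def jetmat_index ta)
    also have "\<dots> = (\<Sum>q \<in> {0..<n} \<inter> {r..a}.
        of_nat (q choose r) * \<zeta> (q - r) * (of_nat (a choose q) * \<psi> (t, a - q)))"
      by (simp add: sum.inter_restrict)
    \<comment> \<open>Since \<open>a < n\<close>, cutting the columns off after \<open>n\<close>
      rows loses no term of the Leibniz sum.\<close>
    also have "{0..<n} \<inter> {r..a} = {r..a}" using an by auto
    also have "(\<Sum>q \<in> {r..a}. of_nat (q choose r) * \<zeta> (q - r) * (of_nat (a choose q) * \<psi> (t, a - q))) =
        jetmat \<xi> L n $$ (r, c)"
    proof (cases "r \<le> a")
      case True
      have "(\<Sum>q \<in> {r..a}. of_nat (q choose r) * \<zeta> (q - r) * (of_nat (a choose q) * \<psi> (t, a - q))) =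
          (\<Sum>s\<le>a - r. of_nat (a choose r) * (of_nat (a - r choose s) * (\<zeta> s * \<psi> (t, a - r - s))))"
      proof (rule sum.reindex_bij_witness[where i = "\<lambda>s. s + r" and j = "\<lambda>q. q - r"], goal_cases)
        case (5 q)
        \<comment> \<open>The product of binomials is rewritten as \<open>a choose r\<close>, which
          is free of \<open>q\<close>, times the Leibniz coefficient of order \<open>a - r\<close>
          at \<open>s = q - r\<close>.\<close>
        have "(a choose q) * (q choose r) = (a choose r) * (a - r choose (q - r))"
          using 5 by (intro choose_mult) auto
        then have "of_nat (a choose q) * of_nat (q choose r) =
            (of_nat (a choose r) * of_nat (a - r choose (q - r)) :: 'a)"
          by (metis of_nat_mult)
        moreover have "a - r - (q - r) = a - q" using 5 by auto
        moreover have "of_nat (q choose r) * \<zeta> (q - r) * (of_nat (a choose q) * \<psi> (t, a - q)) =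
            (of_nat (a choose q) * of_nat (q choose r)) * (\<zeta> (q - r) * \<psi> (t, a - q))"
          by (simp only: mult_ac)
        ultimately show ?case
          by (simp only: mult.assoc)
      qed (use True in auto)
      then show ?thesis
        using True rc by (simp add: jetmat_index ta Leibniz[OF mem] sum_distrib_left)
    qed (use rc in \<open>simp add: jetmat_index ta\<close>)
    finally show "jetmat \<xi> L n $$ (r, c) = (A * jetmat \<psi> L n) $$ (r, c)" ..
  qed (auto simp: A_def)
  then show ?thesis
    using det_mult[OF A jetmat_carrier] detA by metis
qed

text \<open>If index 0 carries the jets of the constant 1, its column with parameter
  \<open>m\<close> is the unit vector in row \<open>m\<close>. Appending these columns in order
  extends the matrix by ones on the diagonal with zeros above them.\<close>

lemma det_jetmat_pad:
  fixes \<xi> :: "jvar \<Rightarrow> 'a::comm_ring_1"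
  assumes "length L = n" "\<xi> (0, 0) = 1" "\<And>l. l > 0 \<Longrightarrow> \<xi> (0, l) = 0"
  shows "Determinant.det (jetmat \<xi> (L @ map (Pair 0) [n..<n + k]) (n + k)) = Determinant.det (jetmat \<xi> L n)"
proof (induction k)
  case (Suc k)
  define m where "m = n + k"
  define K where "K = L @ map (Pair 0) [n..<m]"
  let ?M = "jetmat \<xi> (K @ [(0, m)]) (Suc m)"
  have len: "length K = m" using assms(1) by (simp add: K_def m_def)
  have nth: "(K @ [(0, m)]) ! c = (if c < m then K ! c else (0, m))" if "c < Suc m" for c
    using that len by (auto simp: nth_append less_Suc_eq)
  \<comment> \<open>The lower left block is left unspecified; the zero block above the corner
    already splits the determinant.\<close>
  have "?M = four_block_mat (jetmat \<xi> K m) (0\<^sub>m m 1) (mat 1 m (\<lambda>(_, c). ?M $$ (m, c))) (1\<^sub>m 1)"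
    by (rule eq_matI) (auto simp: jetmat_index nth assms(2,3) less_Suc_eq)
  then have "Determinant.det ?M = Determinant.det (jetmat \<xi> K m) * Determinant.det (1\<^sub>m 1 :: 'a mat)"
    by (metis det_four_block_mat_upper_right_zero_col jetmat_carrier mat_carrier one_carrier_mat)
  then show ?case
    using Suc.IH by (simp add: K_def m_def)
qed simp

lemma subring_closed_det_jetmat:
  assumes "subring_closed R" "length L = n" "\<And>t a b. (t, a) \<in> set L \<Longrightarrow> b \<le> a \<Longrightarrow> \<xi> (t, b) \<in> R"
  shows "Determinant.det (jetmat \<xi> L n) \<in> R"
proof (rule subring_closed_det[OF assms(1) jetmat_carrier])
  fix r c assume rc: "r < n" "c < n"
  then have "L ! c \<in> set L" using assms(2) by simp
  then have "\<xi> (fst (L ! c), snd (L ! c) - r) \<in> R"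
    using assms(3)[of "fst (L ! c)" "snd (L ! c)"] by simp
  then show "jetmat \<xi> L n $$ (r, c) \<in> R"
    using rc subring_closedD[OF assms(1)] subring_closed_of_nat[OF assms(1)] by (simp add: jetmat_index)
qed

section \<open>Jets of the affine coordinates and the sections built from them\<close>

text \<open>The jets of \<open>X_t / X_i\<close> in the chart \<open>U_i\<close>. Including
  \<open>t = i\<close>, where the function is the constant 1, makes the family of all
  \<open>N + 1\<close> blocks symmetric under change of charts.\<close>

definition jetcoord :: "nat \<Rightarrow> jvar \<Rightarrow> (point \<Rightarrow> complex) jpoly" where
  "jetcoord i = (\<lambda>(t, l). if t = i then (if l = 0 then 1 else 0)
     else if l = 0 then Cst (\<lambda>x. x t) else Var (t, l))"

text \<open>The candidate section given by a choice of \<open>n\<close> columns among the blocks.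
  The restriction and the value 0 beyond \<open>N\<close> meet the normalisation of global
  sections.\<close>

definition det_section :: "nat \<Rightarrow> nat \<Rightarrow> (nat \<times> nat) list \<Rightarrow> nat \<Rightarrow> (point \<Rightarrow> complex) jpoly" where
  "det_section N n L i = (if i \<le> N then
     restrict_coeffs (chart N i) (Determinant.det (jetmat (jetcoord i) L n)) else 0)"

lemma Cst_zero [simp]: "Cst 0 = 0"
  by (simp add: Cst_def)

lemma total_deriv_zero [simp]: "total_deriv N i 0 = 0"
  by (simp add: total_deriv_def)

lemma total_deriv_iter_zero [simp]: "(total_deriv N i ^^ l) 0 = 0"
  by (induction l) auto

lemma eval_total_deriv_Cst: "eval_coeffs x (total_deriv N i (Cst c)) = jgrad N i x c"
  unfolding Cst_def[of c] eval_total_deriv_single by (simp add: jderiv_term_def jshift_def)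

lemma eval_total_deriv_Var:
  "eval_coeffs x (total_deriv N i (Var (t, l))) = Var (t, Suc l)"
  unfolding Var_def[of "(t, l)"] eval_total_deriv_single
  by (simp add: jderiv_term_def jshift_def jgrad_def one_fun_def Cst_one Var_def Cst_def)

lemma total_deriv_iter_Cst_one:
  assumes "x \<in> overlap N i j"
  shows "eval_coeffs x ((total_deriv N i ^^ l) (Cst (\<lambda>x. 1))) = (if l = 0 then 1 else 0)"
proof (cases l)
  case (Suc k)
  have "eval_coeffs x ((total_deriv N i ^^ k) (total_deriv N i (Cst (\<lambda>x. 1)))) =
      eval_coeffs x ((total_deriv N i ^^ k) 0)"
    by (rule total_deriv_iter_cong[OF _ assms]) (simp add: eval_total_deriv_Cst jgrad_def)
  then show ?thesis using Suc by (simp add: funpow_Suc_right del: funpow.simps)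
qed (simp add: Cst_one)

lemma total_deriv_iter_Var:
  assumes "x \<in> overlap N i j"
  shows "eval_coeffs x ((total_deriv N i ^^ l) (Var (t, k))) = Var (t, k + l)"
proof (induction l arbitrary: k)
  case (Suc l)
  have "eval_coeffs x ((total_deriv N i ^^ l) (total_deriv N i (Var (t, k)))) =
      eval_coeffs x ((total_deriv N i ^^ l) (Var (t, Suc k)))"
    by (rule total_deriv_iter_cong[OF _ assms]) (simp add: eval_total_deriv_Var)
  then show ?case using Suc by (simp add: funpow_Suc_right del: funpow.simps)
qed simp

text \<open>Puts the constant coordinate \<open>t = i\<close> and the genuine coordinates on the
  same footing: all are iterated derivatives of coordinate functions, so the Leibniz rule treats all
  columns alike.\<close>

lemma eval_jetcoord:
  assumes "t \<le> N" "x \<in> overlap N i j"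
  shows "eval_coeffs x (jetcoord i (t, l)) = eval_coeffs x ((total_deriv N i ^^ l) (Cst (\<lambda>x. x t)))"
proof (cases "t = i")
  case True
  have "eval_coeffs x ((total_deriv N i ^^ l) (Cst (\<lambda>x. x t))) =
      eval_coeffs x ((total_deriv N i ^^ l) (Cst (\<lambda>x. 1)))"
    by (rule total_deriv_iter_cong[OF _ assms(2)]) (simp add: True overlap_def chart_def)
  then show ?thesis
    using True by (simp add: jetcoord_def total_deriv_iter_Cst_one[OF assms(2)])
next
  case False
  show ?thesis
  proof (cases l)
    case (Suc k)
    have "t \<in> coords N i" using assms False by (simp add: coords_def)
    \<comment> \<open>The first derivative of a coordinate is its jet variable of order 1; further
      derivatives only raise the order.\<close>
    then have "jgrad N i y (\<lambda>x. x t) = Var (t, 1)" for y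
      by (simp add: jgrad_def partial_deriv_coord if_distrib[of Cst] Cst_one if_distrib[of "\<lambda>c. c * _"]
          cong: if_cong)
    then have "eval_coeffs x ((total_deriv N i ^^ k) (total_deriv N i (Cst (\<lambda>x. x t)))) =
        eval_coeffs x ((total_deriv N i ^^ k) (Var (t, 1)))"
      by (intro total_deriv_iter_cong[OF _ assms(2)]) (simp add: eval_total_deriv_Cst)
    then show ?thesis
      using Suc False
      by (simp add: funpow_Suc_right total_deriv_iter_Var[OF assms(2)] jetcoord_def del: funpow.simps)
  qed (use False in \<open>simp add: jetcoord_def\<close>)
qed

text \<open>Reduces a change of charts to a substitution in a complex polynomial: coefficients are
  taken at the image point, variables become the jets at \<open>x\<close> of the new
  coordinates.\<close>

lemma eval_change_chart:
  "eval_coeffs x (change_chart N i j p) =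
    jsubst Cst (\<lambda>(t, l). eval_coeffs x ((total_deriv N i ^^ l) (Cst (\<lambda>x. transition j x t))))
      (eval_coeffs (transition j x) p)"
proof -
  let ?\<phi> = "\<lambda>f. Cst (f \<circ> transition j) :: (point \<Rightarrow> complex) jpoly"
  have 1: "comm_ring_hom ?\<phi>"
    by (intro comm_ring_hom_Cst_comp comm_ring_homI) (auto simp: fun_eq_iff)
  have 2: "comm_ring_hom (Cst :: complex \<Rightarrow> _)"
    by (rule comm_ring_homI) (simp_all add: Cst_add Cst_mult Cst_one)
  interpret j1: comm_ring_hom "jsubst ?\<phi> \<sigma>" for \<sigma> by (rule comm_ring_hom_jsubst[OF 1])
  interpret j2: comm_ring_hom "jsubst (Cst :: complex \<Rightarrow> _) \<sigma>" for \<sigma> by (rule comm_ring_hom_jsubst[OF 2])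
  have zero: "?\<phi> 0 = 0" "(Cst 0 :: complex jpoly) = 0"
    by (simp_all add: comp_def flip: zero_fun_def)
  show ?thesis
    unfolding change_chart_def
  proof (induction p rule: poly_mapping_induct)
    case (single m c)
    show ?case
      by (simp only: jsubst_single[of ?\<phi>, OF zero(1)] jsubst_single[of Cst, OF zero(2)] eval_coeffs_single
          eval_coeffs.hom_mult eval_coeffs.hom_prod eval_coeffs.hom_power case_prod_unfold eval_coeffs_Cst)
        (simp only: comp_def)
  qed (simp only: j1.hom_add j2.hom_add eval_coeffs.hom_add)
qed

lemma lookup_Cst_mult: "Poly_Mapping.lookup (Cst c * p) m = c * Poly_Mapping.lookup p m"
  by (induction p rule: poly_mapping_induct)
    (auto simp: Cst_def mult_single lookup_single when_def distrib_left lookup_add)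

lemma transition_in_chart: "x \<in> overlap N i j \<Longrightarrow> transition j x \<in> chart N j"
  by (auto simp: overlap_def chart_def transition_def)

text \<open>On the overlap \<open>x t = x j * (x t / x j)\<close> for every \<open>t\<close>,
  including \<open>i\<close> and \<open>j\<close>. Hence all columns change by the one triangular
  matrix of \<open>x j\<close>, which contributes \<open>x j ^ n\<close>.\<close>

lemma det_section_compatible:
  assumes len: "length L = n" and L: "\<And>t a. (t, a) \<in> set L \<Longrightarrow> t \<le> N \<and> a < n"
    and ij: "i \<le> N" "j \<le> N" and x: "x \<in> overlap N i j"
  shows "Poly_Mapping.lookup (det_section N n L i) m x =
    x j ^ n * Poly_Mapping.lookup (change_chart N i j (det_section N n L j)) m x"
proof -
  let ?D = "\<lambda>l f. eval_coeffs x ((total_deriv N i ^^ l) (Cst f))"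
  define \<sigma> where "\<sigma> = (\<lambda>(t, l). ?D l (\<lambda>x. transition j x t))"
  have x': "x \<in> chart N i" "x j \<noteq> 0" using x by (auto simp: overlap_def)
  have hom: "comm_ring_hom (Cst :: complex \<Rightarrow> _)"
    by (rule comm_ring_homI) (simp_all add: Cst_add Cst_mult Cst_one)
  have cst: "Cst f \<in> regular_jpolys N i j" if "f \<in> regular_on_overlap N i j" for f
    using that by (rule Cst_in_jpoly_over[OF subring_closed_regular])
  \<comment> \<open>For \<open>t = j\<close> the prescribed jets 1, 0, 0, ... must match the
    derivatives of \<open>x j / x j\<close>, which is 1 on the overlap.\<close>
  have \<sigma>: "jsubst Cst \<sigma> (eval_coeffs (transition j x) (jetcoord j (t, l))) = \<sigma> (t, l)" for t l
  proof -
    interpret js: comm_ring_hom "jsubst Cst \<sigma>" by (rule comm_ring_hom_jsubst[OF hom])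
    have "?D l (\<lambda>x. transition j x j) = ?D l (\<lambda>x. 1)"
      by (rule total_deriv_iter_cong[OF _ x]) (simp add: transition_def overlap_def)
    then show ?thesis
      by (auto simp: jetcoord_def total_deriv_iter_Cst_one[OF x] jsubst_Cst[OF hom] jsubst_Var[OF hom])
        (simp_all add: \<sigma>_def total_deriv_iter_Cst_one[OF x])
  qed
  have Leibniz: "eval_coeffs x (jetcoord i (t, b)) =
      (\<Sum>r\<le>b. of_nat (b choose r) * (?D r (\<lambda>x. x j) * \<sigma> (t, b - r)))" if "t \<le> N" for t b
  proof -
    have "(\<lambda>x. transition j x t) \<in> regular_on_overlap N i j"
      using regular_on_overlap.mult[OF regular_on_overlap.coord[of t] regular_on_overlap.inverse]
      by (simp add: transition_def times_fun_def divide_inverse)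
    \<comment> \<open>The factorisation needs \<open>x j \<noteq> 0\<close>, so it is an equality on
      the overlap only; that is enough for the iterated derivatives.\<close>
    moreover have "?D b (\<lambda>x. x t) = eval_coeffs x ((total_deriv N i ^^ b)
        (Cst (\<lambda>x. x j) * Cst (\<lambda>x. transition j x t)))"
      by (rule total_deriv_iter_cong[OF _ x])
        (auto simp: transition_def overlap_def Cst_mult[symmetric] times_fun_def)
    ultimately show ?thesis
      using eval_jetcoord[OF that x]
      by (simp add: total_deriv_iter_Leibniz[OF cst cst x] regular_on_overlap.coord \<sigma>_def)
  qed
  have "eval_coeffs x (det_section N n L i) = Determinant.det (jetmat (\<lambda>v. eval_coeffs x (jetcoord i v)) L n)"
    using ij x' by (simp add: det_section_def eval_restrict_coeffs
        hom_det_jetmat[OF eval_coeffs.comm_ring_hom_axioms])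
  also have "\<dots> = ?D 0 (\<lambda>x. x j) ^ n * Determinant.det (jetmat \<sigma> L n)"
    by (rule det_jetmat_Leibniz[OF len]) (use L Leibniz in auto)
  also have "?D 0 (\<lambda>x. x j) ^ n = Cst (x j ^ n)"
    by (induction n) (auto simp: Cst_one Cst_mult)
  also have "Determinant.det (jetmat \<sigma> L n) =
      Determinant.det (jetmat (\<lambda>v. jsubst Cst \<sigma> (eval_coeffs (transition j x) (jetcoord j v))) L n)"
    by (rule arg_cong[of _ _ Determinant.det], rule jetmat_cong[OF len]) (simp add: \<sigma>)
  also have "\<dots> = jsubst Cst \<sigma> (eval_coeffs (transition j x) (det_section N n L j))"
    using ij transition_in_chart[OF x]
    by (simp add: det_section_def eval_restrict_coeffs hom_det_jetmat[OF eval_coeffs.comm_ring_hom_axioms]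
        hom_det_jetmat[OF comm_ring_hom_jsubst[OF hom]])
  also have "\<dots> = eval_coeffs x (change_chart N i j (det_section N n L j))"
    by (simp add: eval_change_chart \<sigma>_def)
  finally show ?thesis
    by (metis lookup_eval_coeffs lookup_Cst_mult)
qed

section \<open>Holomorphic coefficients and global sections\<close>

lemma chart_fun_upd: "x \<in> chart N i \<Longrightarrow> t \<in> coords N i \<Longrightarrow> x(t := z) \<in> chart N i"
  by (auto simp: chart_def coords_def)

lemma hol_on_chart_cong:
  assumes "hol_on_chart N i (chart N i) f" "\<And>x. x \<in> chart N i \<Longrightarrow> g x = f x"
  shows "hol_on_chart N i (chart N i) g"
proof -
  have "continuous_on (chart N i) g"
    using assms by (simp add: hol_on_chart_def cong: continuous_on_cong)
  moreover have "(\<lambda>z. g (x(t := z))) = (\<lambda>z. f (x(t := z)))" if "x \<in> chart N i" "t \<in> coords N i" for x t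
    using that by (simp add: assms(2) chart_fun_upd)
  ultimately show ?thesis
    using assms(1) by (simp add: hol_on_chart_def)
qed

lemma subring_closed_hol: "subring_closed {f. hol_on_chart N i V f}"
  unfolding subring_closed_def hol_on_chart_def one_fun_def plus_fun_def times_fun_def fun_Compl_def
  by (auto intro!: continuous_intros field_differentiable_add field_differentiable_mult
      field_differentiable_minus)

lemma hol_coord: "hol_on_chart N i V (\<lambda>x. x t)"
proof -
  have "(\<lambda>z. (x(s := z)) t) field_differentiable at (x s)" for x :: point and s
    by (cases "s = t") auto
  then show ?thesis
    by (auto simp: hol_on_chart_def intro: continuous_on_product_coordinates
        continuous_on_subset)
qed

text \<open>Every entry comes from 0, 1, a coordinate function or a jet variable of order at most
  \<open>k\<close>, and the determinant stays in the ring these generate.\<close>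

lemma det_section_chart:
  assumes len: "length L = n" and L: "\<And>t a. (t, a) \<in> set L \<Longrightarrow> t \<le> N \<and> a \<le> k" and "i \<le> N"
  shows "det_section N n L i \<in> GG_chart_sections N k i"
proof -
  let ?H = "{f. hol_on_chart N i (chart N i) f}" and ?V = "coords N i \<times> {1..k}"
  let ?p = "Determinant.det (jetmat (jetcoord i) L n)"
  have R: "subring_closed (jpoly_over ?V ?H)"
    by (intro subring_closed_jpoly_over subring_closed_hol)
  have "jetcoord i (t, b) \<in> jpoly_over ?V ?H" if "(t, a) \<in> set L" "b \<le> a" for t a b
  proof -
    have "t \<noteq> i \<Longrightarrow> t \<in> coords N i" "b \<le> k"
      using L[OF that(1)] that(2) by (auto simp: coords_def)
    then show ?thesis
      using subring_closedD(1,2)[OF R]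
      by (auto simp: jetcoord_def hol_coord intro!: Cst_in_jpoly_over Var_in_jpoly_over subring_closed_hol)
  qed
  then have p: "?p \<in> jpoly_over ?V ?H"
    by (intro subring_closed_det_jetmat R len) auto
  show ?thesis
    unfolding GG_chart_sections_def
  proof (intro CollectI ballI conjI allI impI)
    fix m assume m: "m \<in> Poly_Mapping.keys (det_section N n L i)"
    then obtain x where "Poly_Mapping.lookup (det_section N n L i) m x \<noteq> 0"
      by (auto simp: in_keys_iff fun_eq_iff)
    \<comment> \<open>Restriction to the chart can only kill coefficients, so \<open>m\<close>
      already occurs in the unrestricted determinant.\<close>
    then have "m \<in> Poly_Mapping.keys ?p"
      using \<open>i \<le> N\<close> by (auto simp: in_keys_iff fun_eq_iff det_section_def lookup_restrict_coeffs split: if_splits)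
    then show "Poly_Mapping.keys m \<subseteq> ?V"
      using p by (auto simp: jpoly_over_def)
    have "hol_on_chart N i (chart N i) (Poly_Mapping.lookup ?p m)"
      using p by (simp add: jpoly_over_def)
    then show "hol_on_chart N i (chart N i) (Poly_Mapping.lookup (det_section N n L i) m)"
      by (rule hol_on_chart_cong) (simp add: det_section_def lookup_restrict_coeffs \<open>i \<le> N\<close>)
    show "Poly_Mapping.lookup (det_section N n L i) m x = 0" if "x \<notin> chart N i" for x
      using that by (simp add: det_section_def lookup_restrict_coeffs)
  qed
qed

text \<open>Parameters below \<open>n\<close> involve jets of order at most \<open>n - 1\<close>;
  this is where the bound on \<open>k\<close> enters.\<close>

lemma det_section_H0:
  assumes "length L = n" "\<And>t a. (t, a) \<in> set L \<Longrightarrow> t \<le> N \<and> a < n" "n - 1 \<le> k"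
  shows "det_section N n L \<in> H0_GG N k n"
proof -
  have "a \<le> k" if "(t, a) \<in> set L" for t a using assms(2)[OF that] assms(3) by linarith
  then show ?thesis
    using det_section_chart[OF assms(1), of N k] det_section_compatible[OF assms(1,2)] assms(2)
    unfolding H0_GG_def by (auto simp: det_section_def[of N n L i for i])
qed

text \<open>The twist by \<open>d\<close> calls for a minor of size exactly \<open>d\<close>. The
  columns \<open>(0, n), ..., (0, d - 1)\<close> are the missing unit vectors on
  \<open>U_0\<close>.\<close>

lemma jet_poly_on_U0_det_jetmat:
  assumes "length L = n" "\<And>t a. (t, a) \<in> set L \<Longrightarrow> t \<noteq> 0" "n \<le> d"
  shows "jet_poly_on_U0 N (Determinant.det (jetmat Var L n)) =
    det_section N d (L @ map (Pair 0) [n..<d]) 0"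
proof -
  have hom: "comm_ring_hom (\<lambda>c :: complex. Cst (\<lambda>x :: point. c))"
    by (intro comm_ring_hom_Cst_comp[of "\<lambda>c x. c"] comm_ring_homI) (auto simp: fun_eq_iff)
  have "jsubst (\<lambda>c. Cst (\<lambda>x :: point. c)) (\<lambda>(t, l). if l = 0 then Cst (\<lambda>x. x t) else Var (t, l))
      (Determinant.det (jetmat Var L n)) =
      Determinant.det (jetmat (jetcoord 0) L n)"
    unfolding hom_det_jetmat[OF comm_ring_hom_jsubst[OF hom]] jsubst_Var[OF hom]
    by (rule arg_cong[of _ _ Determinant.det], rule jetmat_cong[OF assms(1)])
      (auto simp: jetcoord_def dest: assms(2))
  also have "\<dots> = Determinant.det (jetmat (jetcoord 0) (L @ map (Pair 0) [n..<d]) d)"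
    using det_jetmat_pad[OF assms(1), of "jetcoord 0" "d - n"] assms(3) by (simp add: jetcoord_def)
  finally show ?thesis
    by (simp add: jet_poly_on_U0_def det_section_def)
qed

lemma belongs_H0_det_jetmat:
  assumes len: "length L = n" and L: "\<And>t a. (t, a) \<in> set L \<Longrightarrow> t \<in> {1..N} \<and> a < d"
    and "n \<le> d" "d - 1 \<le> k"
  shows "belongs_H0 N k d (Determinant.det (jetmat Var L n))"
proof -
  have R: "subring_closed (jpoly_over ({1..N} \<times> {0..k}) (UNIV :: complex set))"
    by (intro subring_closed_jpoly_over) (simp add: subring_closed_def)
  have "Var (t, b) \<in> jpoly_over ({1..N} \<times> {0..k}) (UNIV :: complex set)" if "(t, a) \<in> set L" "b \<le> a" for t a b
    using L[OF that(1)] that(2) assms(4) by (intro Var_in_jpoly_over) (auto simp: subring_closed_def)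
  then have "Determinant.det (jetmat Var L n) \<in> jpoly_over ({1..N} \<times> {0..k}) (UNIV :: complex set)"
    by (rule subring_closed_det_jetmat[OF R len])
  moreover have "det_section N d (L @ map (Pair 0) [n..<d]) \<in> H0_GG N k d"
    using len L \<open>n \<le> d\<close> by (intro det_section_H0[OF _ _ assms(4)]) (auto dest: L)
  moreover have "det_section N d (L @ map (Pair 0) [n..<d]) 0 = jet_poly_on_U0 N (Determinant.det (jetmat Var L n))"
    by (subst jet_poly_on_U0_det_jetmat[OF len _ assms(3)]) (auto dest: L)
  ultimately show ?thesis
    unfolding belongs_H0_def jpoly_over_def by blast
qed


section \<open>Linear independence\<close>

lemma hom_jsubst:
  assumes "comm_ring_hom h"
  shows "h (jsubst \<phi> \<sigma> p) = jsubst (\<lambda>c. h (\<phi> c)) (\<lambda>v. h (\<sigma> v)) p"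
proof -
  interpret comm_ring_hom h by fact
  show ?thesis by (simp add: jsubst_def hom_sum hom_mult hom_prod hom_power)
qed

lemma jsubst_cong:
  assumes "p \<in> jpoly_over V C" "\<And>v. v \<in> V \<Longrightarrow> \<sigma> v = \<tau> v"
  shows "jsubst \<phi> \<sigma> p = jsubst \<phi> \<tau> p"
proof -
  have "jmonom \<sigma> m = jmonom \<tau> m" if "m \<in> Poly_Mapping.keys p" for m
  proof (intro prod.cong refl)
    fix v assume "v \<in> Poly_Mapping.keys m"
    then have "v \<in> V" using assms(1) that by (auto simp: jpoly_over_def)
    then show "\<sigma> v ^ Poly_Mapping.lookup m v = \<tau> v ^ Poly_Mapping.lookup m v"
      by (simp add: assms(2))
  qed
  then show ?thesis by (simp add: jsubst_def)
qed

text \<open>Artin's argument for the linear independence of characters, applied to the monomials as multiplicative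
  functions of the point.\<close>

lemma jmonom_independent:
  fixes c :: "(jvar \<Rightarrow>\<^sub>0 nat) \<Rightarrow> complex"
  assumes "finite K" "\<And>\<xi>. (\<Sum>m\<in>K. c m * jmonom \<xi> m) = 0" "m \<in> K"
  shows "c m = 0"
  using assms
proof (induction K arbitrary: c m)
  case (insert k K)
  have zero: "c m = 0" if "m \<in> K" for m
  proof -
    have "m \<noteq> k" using that insert.hyps by auto
    then obtain v where v: "Poly_Mapping.lookup m v \<noteq> Poly_Mapping.lookup k v"
      by (metis poly_mapping_eqI)
    \<comment> \<open>At \<eta> a monomial takes the value 2 to the power of its exponent in
      \<open>v\<close>, which separates \<open>m\<close> from \<open>k\<close>.\<close>
    define \<eta> where "\<eta> = (\<lambda>w. if w = v then 2 else (1 :: complex))"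
    have \<eta>: "jmonom \<eta> n = 2 ^ Poly_Mapping.lookup n v" for n
    proof -
      have "jmonom \<eta> n = (\<Prod>w\<in>Poly_Mapping.keys n. if w = v then 2 ^ Poly_Mapping.lookup n w else 1)"
        by (rule prod.cong) (auto simp: \<eta>_def)
      then show ?thesis by (auto simp: prod.delta in_keys_iff)
    qed
    \<comment> \<open>Subtracting \<open>jmonom \<eta> k\<close> times the relation at \<xi> from
      the relation at the product of \<eta> and \<xi> eliminates \<open>k\<close>.\<close>
    have "c m * (jmonom \<eta> m - jmonom \<eta> k) = 0"
    proof (rule insert.IH[where c = "\<lambda>n. c n * (jmonom \<eta> n - jmonom \<eta> k)", OF _ that])
      fix \<xi>
      have "(\<Sum>n\<in>K. c n * (jmonom \<eta> n - jmonom \<eta> k) * jmonom \<xi> n) =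
          (\<Sum>n\<in>insert k K. c n * jmonom (\<lambda>w. \<eta> w * \<xi> w) n) - jmonom \<eta> k * (\<Sum>n\<in>insert k K. c n * jmonom \<xi> n)"
        using insert.hyps
        by (simp add: power_mult_distrib prod.distrib sum_distrib_left sum_subtractf algebra_simps)
      then show "(\<Sum>n\<in>K. c n * (jmonom \<eta> n - jmonom \<eta> k) * jmonom \<xi> n) = 0"
        using insert.prems(1) by simp
    qed
    moreover have "(2 :: complex) ^ Poly_Mapping.lookup m v \<noteq> 2 ^ Poly_Mapping.lookup k v"
    proof
      assume "(2 :: complex) ^ Poly_Mapping.lookup m v = 2 ^ Poly_Mapping.lookup k v"
      from arg_cong[OF this, of norm] show False using v by (simp add: norm_power)
    qed
    ultimately show ?thesis by (simp add: \<eta>)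
  qed
  have "c k = 0"
    using insert.prems(1)[of "\<lambda>_. 1"] insert.hyps zero by simp
  then show ?case
    using zero insert.prems(2) by auto
qed simp

lemma jpoly_eqI_eval:
  fixes P :: "complex jpoly"
  assumes "\<And>\<xi>. jsubst (\<lambda>c. c) \<xi> P = 0"
  shows "P = 0"
proof -
  have "Poly_Mapping.lookup P m = 0" if "m \<in> Poly_Mapping.keys P" for m
    using jmonom_independent[OF finite_keys _ that] assms by (simp add: jsubst_def)
  then show ?thesis by (metis in_keys_iff keys_eq_empty ex_in_conv)
qed

lemma comm_ring_hom_id: "comm_ring_hom (\<lambda>c :: 'a::comm_ring_1. c)"
  by (rule comm_ring_homI) auto

text \<open>The order 0 part of \<xi> is the base point: with entry 1 at index 0 and zeros beyond
  \<open>N\<close> it becomes a point of \<open>U_0\<close>. Evaluating the coefficients there and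
  the jet variables at \<xi> recovers the values of \<open>P\<close> from its section.\<close>

lemma jet_poly_on_U0_eval:
  fixes \<xi> :: "jvar \<Rightarrow> complex"
  obtains h :: "(point \<Rightarrow> complex) jpoly \<Rightarrow> complex"
    where "comm_ring_hom h" "\<And>c. h (Cst (\<lambda>x. c)) = c"
      "\<And>P C. P \<in> jpoly_over ({1..N} \<times> UNIV) C \<Longrightarrow> h (jet_poly_on_U0 N P) = jsubst (\<lambda>c. c) \<xi> P"
proof
  define x where "x t = (if t = 0 then 1 else if t \<le> N then \<xi> (t, 0) else 0)" for t
  let ?h = "\<lambda>p. jsubst (\<lambda>c. c) \<xi> (eval_coeffs x p)"
  interpret j: comm_ring_hom "jsubst (\<lambda>c. c) \<xi>"
    by (rule comm_ring_hom_jsubst[OF comm_ring_hom_id])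
  show hom: "comm_ring_hom ?h"
    by (rule comm_ring_homI) (simp_all add: eval_coeffs.hom_add eval_coeffs.hom_mult j.hom_add j.hom_mult)
  show "?h (Cst (\<lambda>x. c)) = c" for c
    by (simp add: jsubst_Cst[OF comm_ring_hom_id])
  show "?h (jet_poly_on_U0 N P) = jsubst (\<lambda>c. c) \<xi> P" if P: "P \<in> jpoly_over ({1..N} \<times> UNIV) C" for P C
  proof -
    have "x \<in> chart N 0" by (auto simp: chart_def x_def)
    then have "?h (jet_poly_on_U0 N P) = ?h (jsubst (\<lambda>c. Cst (\<lambda>x. c))
        (\<lambda>(t, l). if l = 0 then Cst (\<lambda>x. x t) else Var (t, l)) P)"
      by (simp add: jet_poly_on_U0_def eval_restrict_coeffs)
    also have "\<dots> = jsubst (\<lambda>c. c) (\<lambda>v. if snd v = 0 then x (fst v) else \<xi> v) P"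
      unfolding hom_jsubst[OF hom]
      by (intro arg_cong[of _ _ "\<lambda>\<sigma>. jsubst _ \<sigma> P"] arg_cong2[of _ _ _ _ "\<lambda>\<phi> \<sigma>. jsubst \<phi> \<sigma> P"])
        (auto simp: fun_eq_iff jsubst_Cst[OF comm_ring_hom_id] jsubst_Var[OF comm_ring_hom_id])
    also have "\<dots> = jsubst (\<lambda>c. c) \<xi> P"
      by (rule jsubst_cong[OF P]) (auto simp: x_def)
    finally show ?thesis .
  qed
qed

section \<open>Criteria for independence\<close>

lemma (in vector_space) independent_familyI:
  assumes "finite A" and zero: "\<And>u. (\<Sum>i\<in>A. scale (u i) (f i)) = 0 \<Longrightarrow> \<forall>i\<in>A. u i = 0"
  shows "inj_on f A" "independent (f ` A)"
proof -
  show inj: "inj_on f A"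
  proof (rule inj_onI, rule ccontr)
    fix a b assume ab: "a \<in> A" "b \<in> A" "f a = f b" "a \<noteq> b"
    \<comment> \<open>Two equal members would give a relation with coefficients 1 and -1.\<close>
    let ?u = "\<lambda>i. if i = a then 1 else if i = b then - 1 else 0"
    have "(\<Sum>i\<in>A. scale (?u i) (f i)) = (\<Sum>i\<in>{a, b}. scale (?u i) (f i))"
      using assms(1) ab by (intro sum.mono_neutral_right) auto
    also have "\<dots> = 0" using ab by simp
    finally show False using zero ab by fastforce
  qed
  show "independent (f ` A)"
  proof
    assume "dependent (f ` A)"
    then obtain u where u: "\<exists>v\<in>f ` A. u v \<noteq> 0" "(\<Sum>v\<in>f ` A. scale (u v) v) = 0"
      using dependent_finite[of "f ` A"] assms(1) by auto
    then have "(\<Sum>i\<in>A. scale (u (f i)) (f i)) = 0"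
      by (simp add: sum.reindex[OF inj])
    then show False using zero[of "\<lambda>i. u (f i)"] u(1) by auto
  qed
qed

text \<open>The finite set \<open>B\<close> makes a basis of \<open>V\<close> finite, so
  \<open>dim V\<close> is a cardinality against which \<open>S\<close> can be compared.\<close>

lemma (in vector_space) card_le_dim_of_finite_span:
  assumes "finite B" "V \<subseteq> span B" "independent S" "S \<subseteq> V"
  shows "card S \<le> dim V"
proof -
  obtain B' where B': "B' \<subseteq> V" "independent B'" "V \<subseteq> span B'" "card B' = dim V"
    using basis_exists[of V] by blast
  then have "finite B'"
    using independent_span_bound[OF assms(1), of B'] assms(2) by auto
  then show ?thesis
    using independent_span_bound[of B' S] assms(3,4) B' by auto
qed

lemma section_edim_ge_card:
  assumes "section_space.independent S" "S \<subseteq> V"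
  shows "enat (card S) \<le> section_edim V"
  using section_space.card_le_dim_of_finite_span[OF _ _ assms] by (auto simp: section_edim_def)

text \<open>Among the indices with nonzero coefficient take one whose leading weight is maximal. Its
  leading monomial cannot occur in another such polynomial: it is not leading there, so its weight
  would have to be smaller. Ties in weight are harmless because the leading monomials are
  distinct.\<close>

lemma jpoly_leading_independent:
  fixes w :: "(jvar \<Rightarrow>\<^sub>0 nat) \<Rightarrow> int"
  assumes "finite A" "inj_on \<mu> A"
    and lead: "\<And>i. i \<in> A \<Longrightarrow> Poly_Mapping.lookup (P i) (\<mu> i) \<noteq> 0"
    and less: "\<And>i m. i \<in> A \<Longrightarrow> m \<in> Poly_Mapping.keys (P i) \<Longrightarrow> m \<noteq> \<mu> i \<Longrightarrow> w m < w (\<mu> i)"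
    and zero: "(\<Sum>i\<in>A. jpoly_scale (u i) (P i)) = 0"
  shows "\<forall>i\<in>A. u i = 0"
proof (rule ccontr)
  let ?B = "{i \<in> A. u i \<noteq> 0}"
  assume "\<not> (\<forall>i\<in>A. u i = 0)"
  then have B: "finite ((w \<circ> \<mu>) ` ?B)" "(w \<circ> \<mu>) ` ?B \<noteq> {}" using assms(1) by auto
  from Max_in[OF B] obtain i where i: "i \<in> ?B" "Max ((w \<circ> \<mu>) ` ?B) = w (\<mu> i)"
    by auto
  have max: "w (\<mu> j) \<le> w (\<mu> i)" if "j \<in> ?B" for j
    using Max_ge[OF B(1), of "w (\<mu> j)"] that i by auto
  have other: "u j * Poly_Mapping.lookup (P j) (\<mu> i) = 0" if "j \<in> A" "j \<noteq> i" for j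
  proof (rule ccontr)
    assume *: "u j * Poly_Mapping.lookup (P j) (\<mu> i) \<noteq> 0"
    then have "\<mu> i \<in> Poly_Mapping.keys (P j)" by (auto simp: in_keys_iff)
    moreover have "\<mu> i \<noteq> \<mu> j" using assms(2) that i by (auto dest: inj_onD)
    ultimately have "w (\<mu> i) < w (\<mu> j)" using less that by auto
    then show False using max[of j] that * by auto
  qed
  have "0 = (\<Sum>j\<in>A. u j * Poly_Mapping.lookup (P j) (\<mu> i))"
    using arg_cong[OF zero, of "\<lambda>p. Poly_Mapping.lookup p (\<mu> i)"]
    by (simp add: lookup_sum jpoly_scale_def lookup_Cst_mult)
  also have "\<dots> = (\<Sum>j\<in>{i}. u j * Poly_Mapping.lookup (P j) (\<mu> i))"
    using assms(1) i other by (intro sum.mono_neutral_right) auto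
  finally show False using i lead by auto
qed


section \<open>Leading monomials and counting\<close>

text \<open>The strict rearrangement inequality. Any permutation other than \<open>id\<close> has an
  inversion, and undoing it lowers the sum; so \<open>id\<close> is the only minimiser on the finite
  set of permutations.\<close>

lemma sum_decreasing_permute_less:
  fixes u :: "nat \<Rightarrow> int"
  assumes u: "\<And>c c'. c < c' \<Longrightarrow> c' < n \<Longrightarrow> u c' < u c"
    and p: "p permutes {0..<n}" "p \<noteq> id"
  shows "(\<Sum>r = 0..<n. u r * int r) < (\<Sum>r = 0..<n. u (p r) * int r)"
proof -
  let ?F = "\<lambda>p. \<Sum>r = 0..<n. u (p r) * int r"
  have improve: "\<exists>q'. q' permutes {0..<n} \<and> ?F q' < ?F q" if q: "q permutes {0..<n}" "q \<noteq> id" for q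
  proof -
    have "\<exists>r r'. r < r' \<and> r' < n \<and> q r' < q r"
    proof (rule ccontr)
      assume none: "\<nexists>r r'. r < r' \<and> r' < n \<and> q r' < q r"
      have less: "q r < q r'" if "r < r'" "r' < n" for r r'
      proof -
        have "q r \<noteq> q r'"
          using that permutes_inj[OF q(1)] by (auto dest: injD)
        then show ?thesis using none that by (meson linorder_neqE_nat)
      qed
      have "i < n \<longrightarrow> i \<le> q i" for i
      proof (induction i)
        case (Suc i)
        show ?case using less[of i "Suc i"] Suc by auto
      qed simp
      \<comment> \<open>Without inversions \<open>q\<close> is increasing, so
        \<open>i \<le> q i\<close> throughout, which for a permutation of an initial segment forces
        the identity.\<close>
      then have "q = id"
        by (intro permutes_natset_ge[OF q(1)]) auto
      then show False using q by simp
    qed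
    then obtain r r' where r: "r < r'" "r' < n" "q r' < q r" by blast
    let ?\<tau> = "Transposition.transpose r r'"
    have \<tau>: "?\<tau> permutes {0..<n}"
      using r by (intro permutes_swap_id) auto
    \<comment> \<open>Reindexing moves the transposition to the factor \<open>int x\<close>, so only
      \<open>r\<close> and \<open>r'\<close> contribute to the difference.\<close>
    have "?F (q \<circ> ?\<tau>) = (\<Sum>x = 0..<n. u (q x) * int (?\<tau> x))"
      by (subst sum.permute[OF \<tau>]) (simp add: comp_def)
    then have "?F (q \<circ> ?\<tau>) - ?F q = (\<Sum>x = 0..<n. u (q x) * (int (?\<tau> x) - int x))"
      by (simp add: sum_subtractf right_diff_distrib)
    also have "\<dots> = (\<Sum>x \<in> {r, r'}. u (q x) * (int (?\<tau> x) - int x))"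
      by (rule sum.mono_neutral_right) (use r in \<open>auto simp: transpose_def\<close>)
    also have "\<dots> = (u (q r) - u (q r')) * (int r' - int r)"
      using r by (simp add: algebra_simps)
    also have "\<dots> < 0"
    proof -
      have "q r < n" using r q(1) permutes_in_image[of q "{0..<n}" r] by simp
      then have "u (q r) < u (q r')" using u r by blast
      then show ?thesis using r by (intro mult_neg_pos) auto
    qed
    finally show ?thesis
      using permutes_compose[OF \<tau> q(1)] by auto
  qed
  have "finite {p. p permutes {0..<n}}" by (intro finite_permutations) simp
  then have F: "finite (?F ` {p. p permutes {0..<n}})" "?F ` {p. p permutes {0..<n}} \<noteq> {}"
    using permutes_id[of "{0..<n}"] by blast+
  from Min_in[OF this] obtain q where q: "q permutes {0..<n}" "Min (?F ` {p. p permutes {0..<n}}) = ?F q"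
    by auto
  have min: "?F q \<le> ?F q'" if "q' permutes {0..<n}" for q'
    using Min_le[OF F(1), of "?F q'"] that q(2) by auto
  then have "q = id" using improve[OF q(1)] by fastforce
  then show ?thesis
    using min improve[OF p] by fastforce
qed

section \<open>Weights and the leading monomial of a determinant\<close>

text \<open>The weight of \<open>(t, a - r)\<close> is that of \<open>(t, a)\<close>, minus
  \<open>r^2\<close>, minus the cross term \<open>r * (2 * d * t - 2 * a)\<close>. Only the cross
  term depends on how rows are matched with columns.\<close>

definition jweight :: "nat \<Rightarrow> (jvar \<Rightarrow>\<^sub>0 nat) \<Rightarrow> int" where
  "jweight d m = (\<Sum>v\<in>Poly_Mapping.keys m. int (Poly_Mapping.lookup m v) *
     (2 * int d * int (fst v) * int (snd v) - int (snd v) ^ 2))"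

lemma jweight_superset:
  assumes "finite K" "Poly_Mapping.keys m \<subseteq> K"
  shows "jweight d m = (\<Sum>v\<in>K. int (Poly_Mapping.lookup m v) *
     (2 * int d * int (fst v) * int (snd v) - int (snd v) ^ 2))"
  unfolding jweight_def
  by (rule sum.mono_neutral_left) (use assms in \<open>auto simp: in_keys_iff\<close>)

lemma jweight_add: "jweight d (m + n) = jweight d m + jweight d n"
proof -
  let ?K = "Poly_Mapping.keys m \<union> Poly_Mapping.keys n"
  have "jweight d (m + n) = (\<Sum>v\<in>?K. int (Poly_Mapping.lookup (m + n) v) *
     (2 * int d * int (fst v) * int (snd v) - int (snd v) ^ 2))"
    by (rule jweight_superset) (auto dest: subsetD[OF keys_add])
  also have "\<dots> = jweight d m + jweight d n"
    by (subst (1 2) jweight_superset[of ?K]) (auto simp: lookup_add sum.distrib distrib_right)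
  finally show ?thesis .
qed

lemma jweight_sum: "jweight d (sum f I) = (\<Sum>i\<in>I. jweight d (f i))"
  by (induction I rule: infinite_finite_induct) (auto simp: jweight_add, auto simp: jweight_def)

lemma jweight_single:
  "jweight d (Poly_Mapping.single (t, a) 1) = 2 * int d * int t * int a - int a ^ 2"
  by (simp add: jweight_def)

text \<open>The monomial that the permutation \<open>p\<close> contributes to the determinant. Where
  the subtraction is truncated, the binomial coefficient in front is 0.\<close>

definition diag_monom :: "(nat \<times> nat) list \<Rightarrow> (nat \<Rightarrow> nat) \<Rightarrow> jvar \<Rightarrow>\<^sub>0 nat" where
  "diag_monom L p = (\<Sum>r = 0..<length L. Poly_Mapping.single (fst (L ! p r), snd (L ! p r) - r) 1)"

lemma prod_single: "(\<Prod>i\<in>I. Poly_Mapping.single (m i) (c i)) = Poly_Mapping.single (\<Sum>i\<in>I. m i) (\<Prod>i\<in>I. c i)"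
  for c :: "'i \<Rightarrow> 'a::comm_ring_1" and m :: "'i \<Rightarrow> 'b::comm_monoid_add"
  by (induction I rule: infinite_finite_induct) (auto simp: mult_single)

lemma det_jetmat_Var:
  "Determinant.det (jetmat Var L (length L)) =
    (\<Sum>p \<in> {p. p permutes {0..<length L}}. Poly_Mapping.single (diag_monom L p)
      (signof p * (\<Prod>r = 0..<length L. of_nat (snd (L ! p r) choose r)) :: 'a::comm_ring_1))"
proof -
  have entry: "jetmat Var L (length L) $$ (r, c) =
      Poly_Mapping.single (Poly_Mapping.single (fst (L ! c), snd (L ! c) - r) 1) (of_nat (snd (L ! c) choose r) :: 'a)"
    if "r < length L" "c < length L" for r c
    using that mult_single[of 0 "of_nat (snd (L ! c) choose r) :: 'a"
        "Poly_Mapping.single (fst (L ! c), snd (L ! c) - r) 1" 1]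
    by (auto simp: jetmat_index Var_def binomial_eq_0 single_of_nat simp del: One_nat_def)
  have "(\<Prod>r = 0..<length L. jetmat Var L (length L) $$ (r, p r)) = Poly_Mapping.single (diag_monom L p)
      (\<Prod>r = 0..<length L. of_nat (snd (L ! p r) choose r) :: 'a)" if "p permutes {0..<length L}" for p
  proof -
    have "p r < length L" if "r < length L" for r
      using that \<open>p permutes _\<close> permutes_in_image[of p "{0..<length L}" r] by simp
    then show ?thesis
      unfolding diag_monom_def prod_single[symmetric]
      by (intro prod.cong refl) (simp add: entry)
  qed
  then show ?thesis
    unfolding det_def'[OF jetmat_carrier]
    by (intro sum.cong refl) (auto simp: sign_def single_uminus)
qed

text \<open>Along this order \<open>2 * d * t - 2 * a\<close> strictly decreases as long as all
  parameters are below \<open>d\<close>.\<close>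

definition column_less :: "nat \<times> nat \<Rightarrow> nat \<times> nat \<Rightarrow> bool" where
  "column_less = (\<lambda>(t, a) (t', a'). t' < t \<or> t = t' \<and> a < a')"

text \<open>The second condition, with positions counted from 0, keeps the binomial coefficients on
  the diagonal nonzero.\<close>

definition admissible_columns :: "(nat \<times> nat) list \<Rightarrow> bool" where
  "admissible_columns L \<longleftrightarrow> sorted_wrt column_less L \<and> (\<forall>c<length L. c \<le> snd (L ! c))"

lemma det_jetmat_leading:
  assumes L: "admissible_columns L" and d: "\<And>t a. (t, a) \<in> set L \<Longrightarrow> a < d"
  shows "Poly_Mapping.lookup (Determinant.det (jetmat Var L (length L)) :: complex jpoly) (diag_monom L id) \<noteq> 0"
    and "m \<in> Poly_Mapping.keys (Determinant.det (jetmat Var L (length L)) :: complex jpoly) \<Longrightarrow>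
      m \<noteq> diag_monom L id \<Longrightarrow> jweight d m < jweight d (diag_monom L id)"
proof -
  let ?n = "length L"
  let ?P = "Determinant.det (jetmat Var L ?n) :: complex jpoly"
  let ?S = "{p. p permutes {0..<?n}}"
  let ?b = "\<lambda>p. signof p * (\<Prod>r = 0..<?n. of_nat (snd (L ! p r) choose r)) :: complex"
  \<comment> \<open>The factor of \<open>r\<close> in the cross term of the weight.\<close>
  define u where "u c = 2 * int d * int (fst (L ! c)) - 2 * int (snd (L ! c))" for c
  have u: "u c' < u c" if "c < c'" "c' < ?n" for c c'
  proof -
    have "column_less (L ! c) (L ! c')"
      using L that by (auto simp: admissible_columns_def intro: sorted_wrt_nth_less)
    moreover have "snd (L ! c) < d"
      using d[of "fst (L ! c)" "snd (L ! c)"] that by simp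
    moreover have "int d * int (fst (L ! c')) + int d \<le> int d * int (fst (L ! c))" if "fst (L ! c') < fst (L ! c)"
    proof -
      have "int d * (int (fst (L ! c')) + 1) \<le> int d * int (fst (L ! c))"
        using that by (intro mult_left_mono) auto
      then show ?thesis by (simp add: distrib_left)
    qed
    ultimately show ?thesis
      unfolding u_def column_less_def case_prod_unfold by fastforce
  qed
  have le: "r \<le> snd (L ! p r)" if "?b p \<noteq> 0" "r < ?n" for p r
    using that by (auto simp: not_le[symmetric] intro: ccontr)
  \<comment> \<open>A nonzero coefficient gives \<open>r \<le> a\<close> in every row, so the
    subtraction is exact; the first two sums do not depend on \<open>p\<close>.\<close>
  have weight: "jweight d (diag_monom L p) =
      (\<Sum>c = 0..<?n. 2 * int d * int (fst (L ! c)) * int (snd (L ! c)) - int (snd (L ! c)) ^ 2)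
      - (\<Sum>r = 0..<?n. int r ^ 2) - (\<Sum>r = 0..<?n. u (p r) * int r)"
    if p: "p permutes {0..<?n}" "?b p \<noteq> 0" for p
  proof -
    have "jweight d (diag_monom L p) = (\<Sum>r = 0..<?n.
        (2 * int d * int (fst (L ! p r)) * int (snd (L ! p r)) - int (snd (L ! p r)) ^ 2)
        - int r ^ 2 - u (p r) * int r)"
      unfolding diag_monom_def jweight_sum jweight_single
      by (rule sum.cong) (use le[OF p(2)] in \<open>auto simp: u_def of_nat_diff power2_eq_square algebra_simps\<close>)
    then show ?thesis
      using sum.permute[OF p(1), of "\<lambda>c. 2 * int d * int (fst (L ! c)) * int (snd (L ! c)) - int (snd (L ! c)) ^ 2"]
      by (simp add: sum_subtractf comp_def)
  qed
  have b_id: "?b id \<noteq> 0"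
    using L by (auto simp: admissible_columns_def)
  have less: "jweight d (diag_monom L p) < jweight d (diag_monom L id)"
    if "p permutes {0..<?n}" "?b p \<noteq> 0" "p \<noteq> id" for p
    using weight[OF that(1,2)] weight[OF permutes_id b_id] sum_decreasing_permute_less[of ?n u p] u that
    by simp
  have lookup: "Poly_Mapping.lookup ?P m = (\<Sum>p\<in>?S. ?b p when diag_monom L p = m)" for m
    by (simp add: det_jetmat_Var lookup_sum lookup_single)
  have fin: "finite ?S" by (intro finite_permutations) simp
  \<comment> \<open>No cancellation can occur: every other contributing permutation has a monomial
    of smaller weight.\<close>
  have "(\<Sum>p\<in>?S. ?b p when diag_monom L p = diag_monom L id) = (\<Sum>p\<in>{id}. ?b p when diag_monom L p = diag_monom L id)"
  proof (rule sum.mono_neutral_right[OF fin])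
    show "\<forall>p\<in>?S - {id}. (?b p when diag_monom L p = diag_monom L id) = 0"
    proof
      fix p assume p: "p \<in> ?S - {id}"
      show "(?b p when diag_monom L p = diag_monom L id) = 0"
      proof (rule ccontr)
        assume "(?b p when diag_monom L p = diag_monom L id) \<noteq> 0"
        then have "?b p \<noteq> 0" "diag_monom L p = diag_monom L id"
          unfolding when_def by presburger+
        then show False using less[of p] p by simp
      qed
    qed
  qed (simp add: permutes_id)
  then show "Poly_Mapping.lookup ?P (diag_monom L id) \<noteq> 0"
    using b_id by (simp add: lookup)
  assume m: "m \<in> Poly_Mapping.keys ?P" "m \<noteq> diag_monom L id"
  then have "\<exists>p\<in>?S. (?b p when diag_monom L p = m) \<noteq> 0"
    unfolding in_keys_iff lookup by (meson sum.neutral)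
  then show "jweight d m < jweight d (diag_monom L id)"
    using less m(2) by (auto simp: when_def split: if_splits)
qed

section \<open>Recovering the columns from the leading monomial\<close>

text \<open>The head of each list occurs in the other one, so antisymmetry identifies the
  heads.\<close>

lemma sorted_wrt_mset_unique:
  assumes "sorted_wrt R xs" "sorted_wrt R ys" "mset xs = mset ys"
    and antisym: "\<And>x y. R x y \<Longrightarrow> R y x \<Longrightarrow> x = y"
  shows "xs = ys"
  using assms(1-3)
proof (induction xs arbitrary: ys)
  case (Cons x xs)
  then obtain y zs where ys: "ys = y # zs" by (cases ys) auto
  have "x \<in> set ys" "y \<in> set (x # xs)"
    using Cons.prems(3) ys by (metis list.set_intros(1) set_mset_mset)+
  then have "x = y"
    using Cons.prems(1,2) ys antisym by auto
  then show ?case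
    using Cons ys by auto
qed simp

lemma lookup_sum_list_single:
  "Poly_Mapping.lookup (sum_list (map (\<lambda>v. Poly_Mapping.single v 1) xs)) v = count (mset xs) v"
  by (induction xs) (auto simp: lookup_add lookup_single when_def)

text \<open>The monomial records only a multiset of variables; sortedness turns it back into the
  list along the diagonal, and the position gives back the amount subtracted.\<close>

lemma diag_monom_inj:
  assumes L: "admissible_columns L" and K: "admissible_columns K"
    and eq: "diag_monom L id = diag_monom K id"
  shows "L = K"
proof -
  let ?\<nu> = "\<lambda>L. map (\<lambda>c. (fst (L ! c), snd (L ! c) - c)) [0..<length L]"
  let ?R = "\<lambda>(t :: nat, a :: nat) (t', a'). t' < t \<or> t = t' \<and> a \<le> a'"
  have antisym: "x = y" if "?R x y" "?R y x" for x y
    using that by (cases x; cases y) auto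
  have diag: "diag_monom L id = sum_list (map (\<lambda>v. Poly_Mapping.single v 1) (?\<nu> L))" for L
    by (simp add: diag_monom_def comp_def interv_sum_list_conv_sum_set_nat)
  \<comment> \<open>Within a block \<open>a\<close> grows by at least 1 while the position grows by
    exactly 1, so \<open>a - c\<close> is weakly increasing.\<close>
  have sorted: "sorted_wrt ?R (?\<nu> L)" if "admissible_columns L" for L
  proof -
    have "transp ?R" by (auto simp: transp_def)
    moreover have "?R (?\<nu> L ! c) (?\<nu> L ! Suc c)" if "Suc c < length L" for c
    proof -
      have "column_less (L ! c) (L ! Suc c)"
        using \<open>admissible_columns L\<close> that by (auto simp: admissible_columns_def intro: sorted_wrt_nth_less)
      then show ?thesis
        using that by (auto simp: column_less_def case_prod_unfold)
    qed
    ultimately show ?thesis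
      unfolding sorted_wrt_iff_nth_Suc_transp[OF \<open>transp ?R\<close>] by simp
  qed
  have "mset (?\<nu> L) = mset (?\<nu> K)"
  proof (rule multiset_eqI)
    fix v
    have "count (mset (?\<nu> M)) v = Poly_Mapping.lookup (diag_monom M id) v" for M
      by (simp only: diag lookup_sum_list_single)
    then show "count (mset (?\<nu> L)) v = count (mset (?\<nu> K)) v"
      by (simp only: eq)
  qed
  then have eq: "?\<nu> L = ?\<nu> K"
    by (rule sorted_wrt_mset_unique[OF sorted[OF L] sorted[OF K] _ antisym])
  have len: "length L = length K"
    using arg_cong[OF eq, of length] by simp
  show ?thesis
  proof (rule nth_equalityI[OF len])
    fix c assume c: "c < length L"
    then have "?\<nu> L ! c = ?\<nu> K ! c" using eq by simp
    then have "fst (L ! c) = fst (K ! c)" "snd (L ! c) - c = snd (K ! c) - c"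
      using c len by auto
    moreover have "c \<le> snd (L ! c)" "c \<le> snd (K ! c)"
      using L K c len by (auto simp: admissible_columns_def)
    ultimately show "L ! c = K ! c" by (simp add: prod_eq_iff)
  qed
qed

section \<open>Columns attached to the tuples\<close>

lemma strict_sorted_nth_ge:
  fixes xs :: "nat list"
  assumes "sorted_wrt (<) xs" "\<And>a. a \<in> set xs \<Longrightarrow> s \<le> a" "i < length xs"
  shows "s + i \<le> xs ! i"
  using assms(3)
proof (induction i)
  case (Suc i)
  then show ?case
    using sorted_wrt_nth_less[OF assms(1), of i "Suc i"] by simp
qed (use assms(2) in simp)

text \<open>The block of index \<open>m\<close> starts at position
  \<open>tail_length N \<alpha> (Suc m)\<close>, which bounds its parameters from below; strict
  increase inside the block then keeps each parameter at least its position.\<close>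

lemma column_list_props:
  assumes \<alpha>: "\<alpha> \<in> BNplus N"
  shows "length (column_list N \<alpha>) = tail_length N \<alpha> 1" and "admissible_columns (column_list N \<alpha>)"
proof -
  define C where "C m = concat (map (\<lambda>j. map (Pair j) (\<alpha> j)) (rev [m..<Suc N]))" for m
  have "length (C m) = tail_length N \<alpha> m \<and> admissible_columns (C m)" if "m \<le> Suc N" "1 \<le> m" for m
    using that
  proof (induction m rule: inc_induct)
    case base
    show ?case by (simp add: C_def tail_length_def admissible_columns_def)
  next
    case (step m)
    have C: "C m = C (Suc m) @ map (Pair m) (\<alpha> m)"
      using step.hyps by (simp add: C_def upt_rec[of m "Suc N"] del: upt_Suc)
    have tail: "tail_length N \<alpha> m = length (\<alpha> m) + tail_length N \<alpha> (Suc m)"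
      using step.hyps by (simp add: tail_length_def sum.atLeast_Suc_atMost)
    have IH: "length (C (Suc m)) = tail_length N \<alpha> (Suc m)" "admissible_columns (C (Suc m))"
      using step by auto
    have m: "m \<in> {1..N}" using step by simp
    then have sorted: "sorted_wrt (<) (\<alpha> m)" and ge: "\<And>a. a \<in> set (\<alpha> m) \<Longrightarrow> tail_length N \<alpha> (Suc m) \<le> a"
      using \<alpha> by (auto simp: BNplus_def)
    have "m < t" if "(t, a) \<in> set (C (Suc m))" for t a
      using that by (auto simp: C_def)
    then have "sorted_wrt column_less (C m)"
      using IH sorted by (auto simp: C sorted_wrt_append admissible_columns_def column_less_def sorted_wrt_map)
    moreover have "c \<le> snd (C m ! c)" if "c < length (C m)" for c
    proof (cases "c < length (C (Suc m))")
      case True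
      then show ?thesis using IH by (simp add: C nth_append admissible_columns_def)
    next
      case False
      define i where "i = c - length (C (Suc m))"
      have "i < length (\<alpha> m)" "c = length (C (Suc m)) + i"
        using that False by (auto simp: C i_def)
      then show ?thesis
        using strict_sorted_nth_ge[OF sorted ge, of i] IH by (simp add: C nth_append)
    qed
    ultimately show ?case
      using tail IH by (simp add: C admissible_columns_def)
  qed
  from this[of 1] show "length (column_list N \<alpha>) = tail_length N \<alpha> 1" "admissible_columns (column_list N \<alpha>)"
    by (auto simp: C_def column_list_def)
qed

lemma set_column_list: "set (column_list N \<alpha>) = (SIGMA t:{1..N}. set (\<alpha> t))"
  by (auto simp: column_list_def)

lemma column_list_inj:
  assumes "\<alpha> \<in> BNplus N" "\<beta> \<in> BNplus N" "column_list N \<alpha> = column_list N \<beta>"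
  shows "\<alpha> = \<beta>"
proof
  fix t
  \<comment> \<open>Each index heads one block only, so filtering by it returns exactly the sequence
    of that index.\<close>
  have filter: "filter (\<lambda>q. fst q = t) (concat (map (\<lambda>j. map (Pair j) (\<alpha> j)) js)) =
      (if t \<in> set js then map (Pair t) (\<alpha> t) else [])" if "distinct js" for js and \<alpha> :: "nat \<Rightarrow> nat list"
    using that by (induction js) (auto simp: filter_map comp_def filter_empty_conv)
  have "map (Pair t) (\<alpha> t) = map (Pair t) (\<beta> t)" if "t \<in> {1..N}"
    using filter[of "rev [1..<Suc N]" \<alpha>] filter[of "rev [1..<Suc N]" \<beta>] that assms(3)
    by (auto simp: column_list_def simp del: upt_Suc)
  then show "\<alpha> t = \<beta> t"
    using assms(1,2) by (cases "t \<in> {1..N}") (auto simp: BNplus_def inj_on_def dest!: map_injective)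
qed

definition BNplus_below :: "nat \<Rightarrow> nat \<Rightarrow> (nat \<Rightarrow> nat list) set" where
  "BNplus_below N d = {\<alpha> \<in> BNplus N. \<forall>j\<in>{1..N}. \<forall>a\<in>set (\<alpha> j). a < d}"

text \<open>The convention -1 for the empty tuple agrees with the bound over the integers, also when
  \<open>d = 0\<close>.\<close>

lemma max_entry_less_iff:
  "max_entry N \<alpha> \<le> int d - 1 \<longleftrightarrow> (\<forall>j\<in>{1..N}. \<forall>a\<in>set (\<alpha> j). a < d)"
proof (cases "\<forall>j\<in>{1..N}. \<alpha> j = []")
  case False
  let ?U = "\<Union>j\<in>{1..N}. set (\<alpha> j)"
  have "finite ?U" "?U \<noteq> {}" using False by auto
  then have "Max ?U < d \<longleftrightarrow> (\<forall>a\<in>?U. a < d)" by simp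
  then show ?thesis
    using False by (auto simp: max_entry_def)
qed (simp add: max_entry_def)

lemma BNplus_max_entry: "{\<alpha> \<in> BNplus N. max_entry N \<alpha> \<le> int d - 1} = BNplus_below N d"
  by (simp only: BNplus_below_def max_entry_less_iff)

lemma column_list_below:
  assumes "\<alpha> \<in> BNplus_below N d"
  shows "(t, a) \<in> set (column_list N \<alpha>) \<Longrightarrow> t \<in> {1..N} \<and> a < d"
    and "length (column_list N \<alpha>) \<le> d"
proof -
  show *: "t \<in> {1..N} \<and> a < d" if "(t, a) \<in> set (column_list N \<alpha>)" for t a
    using assms that by (auto simp: set_column_list BNplus_below_def)
  let ?L = "column_list N \<alpha>"
  show "length ?L \<le> d"
  proof (cases "length ?L")
    case (Suc n)
    \<comment> \<open>The last of \<open>Suc n\<close> columns has a parameter at least its position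
      \<open>n\<close> and below \<open>d\<close>.\<close>
    then have "n \<le> snd (?L ! n)"
      using column_list_props(2)[of \<alpha> N] assms by (auto simp: BNplus_below_def admissible_columns_def)
    moreover have "snd (?L ! n) < d"
      using *[of "fst (?L ! n)" "snd (?L ! n)"] Suc by simp
    ultimately show ?thesis using Suc by simp
  qed simp
qed

section \<open>Counting the tuples\<close>

text \<open>Expanding a product of factors \<open>1 + c\<close> over \<open>A\<close> chooses 1 on a
  subset and \<open>c\<close> on its complement.\<close>

lemma sum_power_Pow_card:
  fixes c :: nat
  assumes "finite A"
  shows "(\<Sum>X\<in>Pow A. c ^ (card A - card X)) = (c + 1) ^ card A"
proof -
  have "(c + 1) ^ card A = (\<Prod>x\<in>A. 1 + c)" by simp
  also have "\<dots> = (\<Sum>X\<in>Pow A. (\<Prod>x\<in>X. 1) * (\<Prod>x\<in>A - X. c))"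
    by (rule prod_add[OF assms])
  also have "\<dots> = (\<Sum>X\<in>Pow A. c ^ (card A - card X))"
    by (rule sum.cong) (use assms in \<open>auto simp: card_Diff_subset finite_subset\<close>)
  finally show ?thesis by simp
qed

lemma bij_betw_strict_sorted_lists:
  assumes "finite A"
  shows "bij_betw set {l :: nat list. sorted_wrt (<) l \<and> set l \<subseteq> A} (Pow A)"
proof (rule bij_betwI[where g = sorted_list_of_set])
  show "sorted_list_of_set \<in> Pow A \<rightarrow> {l. sorted_wrt (<) l \<and> set l \<subseteq> A}"
    using assms by (auto simp: finite_subset)
  show "set (sorted_list_of_set X) = X" if "X \<in> Pow A" for X
    using that assms by (auto simp: finite_subset)
  show "sorted_list_of_set (set l) = l" if "l \<in> {l. sorted_wrt (<) l \<and> set l \<subseteq> A}" for l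
    using that by (intro sorted_distinct_set_unique) (auto simp: strict_sorted_iff)
qed auto

text \<open>The shift makes the count recursive: removing the sequence with the largest index from a tuple
  with parameter \<open>s\<close> leaves a tuple whose parameter is increased by the length of that sequence.\<close>

definition shifted_tuples :: "nat \<Rightarrow> nat \<Rightarrow> nat \<Rightarrow> (nat \<Rightarrow> nat list) set" where
  "shifted_tuples n s d = {\<alpha>. (\<forall>j. j \<notin> {1..n} \<longrightarrow> \<alpha> j = []) \<and>
     (\<forall>j\<in>{1..n}. sorted_wrt (<) (\<alpha> j) \<and>
       (\<forall>a\<in>set (\<alpha> j). s + tail_length n \<alpha> (Suc j) \<le> a \<and> a < d))}"

text \<open>The sequence of largest index has tail length 0, so it is bounded by \<open>s\<close>
  alone, while its length enters every other tail length and is absorbed into the shift.\<close>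

lemma shifted_tuples_Suc:
  "shifted_tuples (Suc n) s d = (\<lambda>(l, \<alpha>). \<alpha>(Suc n := l)) `
     (SIGMA l:{l. sorted_wrt (<) l \<and> set l \<subseteq> {s..<d}}. shifted_tuples n (s + length l) d)"
  (is "?T = ?f ` ?S")
proof -
  have tail: "tail_length (Suc n) (\<alpha>(Suc n := l)) (Suc j) = length l + tail_length n \<alpha> (Suc j)"
    if "j \<le> n" for \<alpha> l j
  proof -
    have "(\<Sum>t = Suc j..n. length ((\<alpha>(Suc n := l)) t)) = (\<Sum>t = Suc j..n. length (\<alpha> t))"
      by (rule sum.cong) auto
    then show ?thesis using that by (simp add: tail_length_def)
  qed
  have tail': "tail_length (Suc n) \<alpha> (Suc (Suc n)) = 0" for \<alpha>
    by (simp add: tail_length_def)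
  have iff: "\<alpha>(Suc n := l) \<in> ?T \<longleftrightarrow> (l, \<alpha>) \<in> ?S" if "\<alpha> (Suc n) = []" for \<alpha> l
  proof -
    let ?\<beta> = "\<alpha>(Suc n := l)"
    have set: "{1..Suc n} = insert (Suc n) {1..n}" by auto
    have upd: "?\<beta> j = \<alpha> j" "tail_length (Suc n) ?\<beta> (Suc j) = length l + tail_length n \<alpha> (Suc j)"
      if "j \<in> {1..n}" for j
      using that tail by auto
    have "(\<forall>j. j \<notin> {1..Suc n} \<longrightarrow> ?\<beta> j = []) \<longleftrightarrow> (\<forall>j. j \<notin> {1..n} \<longrightarrow> \<alpha> j = [])"
      using that by (metis atLeastAtMost_iff fun_upd_apply le_Suc_eq order_refl le_SucI One_nat_def Suc_le_mono zero_le)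
    then show ?thesis
      unfolding shifted_tuples_def set ball_simps mem_Collect_eq mem_Sigma_iff
      by (simp add: upd tail' add.assoc subset_iff cong: ball_cong_simp) blast
  qed
  show ?thesis
  proof (intro equalityI subsetI)
    fix \<alpha> assume "\<alpha> \<in> ?T"
    then have "(\<alpha> (Suc n), \<alpha>(Suc n := [])) \<in> ?S"
      by (subst iff[symmetric]) auto
    then show "\<alpha> \<in> ?f ` ?S" by (rule rev_image_eqI) auto
  next
    fix \<alpha> assume "\<alpha> \<in> ?f ` ?S"
    then obtain l \<beta> where "(l, \<beta>) \<in> ?S" "\<alpha> = \<beta>(Suc n := l)" by auto
    moreover from this have "\<beta> (Suc n) = []" by (auto simp: shifted_tuples_def)
    ultimately show "\<alpha> \<in> ?T" using iff by blast
  qed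
qed

text \<open>The removed sequence is a subset of \<open>{s..<d}\<close>, and each of its elements
  lowers the exponent of the remaining count by 1; summing over subsets raises the base from
  \<open>n + 1\<close> to \<open>n + 2\<close>.\<close>

lemma card_shifted_tuples:
  assumes "s \<le> d"
  shows "finite (shifted_tuples n s d) \<and> card (shifted_tuples n s d) = (n + 1) ^ (d - s)"
  using assms
proof (induction n arbitrary: s)
  case 0
  have "shifted_tuples 0 s d = {\<lambda>_. []}"
    by (auto simp: shifted_tuples_def)
  then show ?case by simp
next
  case (Suc n)
  let ?A = "{s..<d}"
  let ?L = "{l :: nat list. sorted_wrt (<) l \<and> set l \<subseteq> ?A}"
  let ?S = "SIGMA l:?L. shifted_tuples n (s + length l) d"
  have bij: "bij_betw set ?L (Pow ?A)" by (rule bij_betw_strict_sorted_lists) simp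
  then have "finite ?L" using bij_betw_finite by blast
  \<comment> \<open>The bound keeps the increased shift at most \<open>d\<close>, as the induction
    hypothesis demands.\<close>
  have len: "length l = card (set l)" "s + length l \<le> d" if "l \<in> ?L" for l
  proof -
    show len: "length l = card (set l)"
      using that by (simp add: strict_sorted_iff distinct_card)
    have "card (set l) \<le> card ?A" using that by (intro card_mono) auto
    then show "s + length l \<le> d" using len Suc.prems by simp
  qed
  have fin: "finite (shifted_tuples n (s + length l) d)" if "l \<in> ?L" for l
    using Suc.IH len(2)[OF that] by blast
  have "inj_on (\<lambda>(l, \<alpha>). \<alpha>(Suc n := l)) ?S"
  proof (rule inj_onI, clarsimp)
    fix l l' and \<alpha> \<beta> :: "nat \<Rightarrow> nat list"
    assume eq: "\<alpha>(Suc n := l) = \<beta>(Suc n := l')"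
      and mem: "\<alpha> \<in> shifted_tuples n (s + length l) d" "\<beta> \<in> shifted_tuples n (s + length l') d"
    have "\<alpha> (Suc n) = []" "\<beta> (Suc n) = []" using mem by (auto simp: shifted_tuples_def)
    then have "\<alpha> j = \<beta> j" for j using fun_cong[OF eq, of j] by (cases "j = Suc n") auto
    then show "l = l' \<and> \<alpha> = \<beta>" using fun_cong[OF eq, of "Suc n"] by auto
  qed
  then have "card (shifted_tuples (Suc n) s d) = card ?S"
    unfolding shifted_tuples_Suc by (rule card_image)
  also have "\<dots> = (\<Sum>l\<in>?L. card (shifted_tuples n (s + length l) d))"
    using \<open>finite ?L\<close> fin by (intro card_SigmaI) auto
  also have "\<dots> = (\<Sum>l\<in>?L. (n + 1) ^ (card ?A - card (set l)))"
  proof (rule sum.cong[OF refl])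
    fix l assume "l \<in> ?L"
    note l = len[OF this]
    then show "card (shifted_tuples n (s + length l) d) = (n + 1) ^ (card ?A - card (set l))"
      using Suc.IH[OF l(2)] by (simp flip: l(1))
  qed
  also have "\<dots> = (\<Sum>X\<in>Pow ?A. (n + 1) ^ (card ?A - card X))"
    by (rule sum.reindex_bij_betw[OF bij])
  also have "\<dots> = (Suc n + 1) ^ (d - s)"
    by (subst sum_power_Pow_card) auto
  finally show ?case
    using \<open>finite ?L\<close> fin unfolding shifted_tuples_Suc by (auto intro!: finite_imageI finite_SigmaI)
qed

lemma card_BNplus_below: "finite (BNplus_below N d)" "card (BNplus_below N d) = (N + 1) ^ d"
proof -
  have "BNplus_below N d = shifted_tuples N 0 d"
    by (auto simp: BNplus_below_def BNplus_def shifted_tuples_def)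
  then show "finite (BNplus_below N d)" "card (BNplus_below N d) = (N + 1) ^ d"
    using card_shifted_tuples[of 0 d N] by auto
qed


section \<open>Independence of the sections and the dimension bound\<close>

lemma det_Delta0_independent:
  assumes "(\<Sum>\<alpha>\<in>BNplus_below N d. jpoly_scale (u \<alpha>) (det_Delta0 N \<alpha>)) = 0"
  shows "\<forall>\<alpha>\<in>BNplus_below N d. u \<alpha> = 0"
proof (rule jpoly_leading_independent[OF _ _ _ _ assms])
  let ?\<mu> = "\<lambda>\<alpha>. diag_monom (column_list N \<alpha>) id"
  have BN: "\<alpha> \<in> BNplus N" if "\<alpha> \<in> BNplus_below N d" for \<alpha>
    using that by (simp add: BNplus_below_def)
  have det: "det_Delta0 N \<alpha> = Determinant.det (jetmat Var (column_list N \<alpha>) (length (column_list N \<alpha>)))"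
    if "\<alpha> \<in> BNplus_below N d" for \<alpha>
    using column_list_props(1)[OF BN[OF that]] by (simp add: det_Delta0_jetmat)
  show "finite (BNplus_below N d)" by (rule card_BNplus_below)
  show "inj_on ?\<mu> (BNplus_below N d)"
    by (intro inj_onI column_list_inj[of _ N] diag_monom_inj column_list_props BN)
  fix \<alpha> assume \<alpha>: "\<alpha> \<in> BNplus_below N d"
  note leading = det_jetmat_leading[OF column_list_props(2)[OF BN[OF \<alpha>]], of d]
  have d: "a < d" if "(t, a) \<in> set (column_list N \<alpha>)" for t a
    using column_list_below(1)[OF \<alpha> that] by simp
  show "Poly_Mapping.lookup (det_Delta0 N \<alpha>) (?\<mu> \<alpha>) \<noteq> 0"
    unfolding det[OF \<alpha>] by (rule leading(1)[OF d])
  show "jweight d m < jweight d (?\<mu> \<alpha>)" if "m \<in> Poly_Mapping.keys (det_Delta0 N \<alpha>)" "m \<noteq> ?\<mu> \<alpha>" for m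
    by (rule leading(2)[OF d that(1)[unfolded det[OF \<alpha>]] that(2)])
qed

text \<open>Transfers relations from sections to polynomials: the component on \<open>U_0\<close>,
  evaluated at every jet \<xi>, determines the polynomial.\<close>

lemma section_independent_of_jpoly:
  assumes "finite A" and P: "\<And>i. i \<in> A \<Longrightarrow> P i \<in> jpoly_over ({1..N} \<times> UNIV) C"
    and s: "\<And>i. i \<in> A \<Longrightarrow> s i 0 = jet_poly_on_U0 N (P i)"
    and zero: "(\<Sum>i\<in>A. section_scale (u i) (s i)) = 0"
  shows "(\<Sum>i\<in>A. jpoly_scale (u i) (P i)) = 0"
proof (rule jpoly_eqI_eval)
  fix \<xi>
  obtain h :: "(point \<Rightarrow> complex) jpoly \<Rightarrow> complex" where h: "comm_ring_hom h" "\<And>c. h (Cst (\<lambda>x. c)) = c"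
    "\<And>P C. P \<in> jpoly_over ({1..N} \<times> UNIV) C \<Longrightarrow> h (jet_poly_on_U0 N P) = jsubst (\<lambda>c. c) \<xi> P"
    using jet_poly_on_U0_eval by metis
  interpret h: comm_ring_hom h by (rule h)
  interpret j: comm_ring_hom "jsubst (\<lambda>c. c) \<xi>"
    by (rule comm_ring_hom_jsubst[OF comm_ring_hom_id])
  have "(\<Sum>i\<in>A. section_scale (u i) (s i)) 0 = (\<Sum>i\<in>A. Cst (\<lambda>x. u i) * s i 0)"
    using assms(1) by induction (auto simp: section_scale_def)
  then have "0 = h (\<Sum>i\<in>A. Cst (\<lambda>x. u i) * s i 0)"
    using zero by simp
  also have "\<dots> = (\<Sum>i\<in>A. u i * jsubst (\<lambda>c. c) \<xi> (P i))"
    by (simp add: h.hom_sum h.hom_mult h(2) s h(3)[OF P])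
  also have "\<dots> = jsubst (\<lambda>c. c) \<xi> (\<Sum>i\<in>A. jpoly_scale (u i) (P i))"
    by (simp add: j.hom_sum j.hom_mult jpoly_scale_def jsubst_Cst[OF comm_ring_hom_id])
  finally show "jsubst (\<lambda>c. c) \<xi> (\<Sum>i\<in>A. jpoly_scale (u i) (P i)) = 0" ..
qed

theorem theorem1p5:
  fixes N d k :: nat
  assumes "N \<ge> 1" and "d \<ge> 1" and "k \<ge> d - 1"
  shows "(\<forall>\<alpha>\<in>BNplus N. max_entry N \<alpha> \<le> int d - 1 \<longrightarrow> belongs_H0 N k d (det_Delta0 N \<alpha>))
    \<and> inj_on (det_Delta0 N) {\<alpha>\<in>BNplus N. max_entry N \<alpha> \<le> int d - 1}
    \<and> jpoly_space.independent (det_Delta0 N ` {\<alpha>\<in>BNplus N. max_entry N \<alpha> \<le> int d - 1})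
    \<and> enat ((N + 1) ^ d) \<le> section_edim (H0_GG N k d)"
proof -
  let ?A = "BNplus_below N d"
  have fin: "finite ?A" by (rule card_BNplus_below)
  have belongs: "belongs_H0 N k d (det_Delta0 N \<alpha>)" if "\<alpha> \<in> ?A" for \<alpha>
  proof -
    have len: "length (column_list N \<alpha>) = tail_length N \<alpha> 1"
      using that by (intro column_list_props) (simp add: BNplus_below_def)
    show ?thesis
      unfolding det_Delta0_jetmat
      using column_list_below[OF that] assms(3) by (intro belongs_H0_det_jetmat[OF len]) (auto simp: len)
  qed
  then have "\<forall>\<alpha>\<in>?A. \<exists>s. s \<in> H0_GG N k d \<and> s 0 = jet_poly_on_U0 N (det_Delta0 N \<alpha>)"
    unfolding belongs_H0_def by blast
  \<comment> \<open>Independence is tested on the component over \<open>U_0\<close>, so any sections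
    extending the determinants serve.\<close>
  then obtain s where s: "\<And>\<alpha>. \<alpha> \<in> ?A \<Longrightarrow> s \<alpha> \<in> H0_GG N k d"
    "\<And>\<alpha>. \<alpha> \<in> ?A \<Longrightarrow> s \<alpha> 0 = jet_poly_on_U0 N (det_Delta0 N \<alpha>)"
    by (metis bchoice)
  have over: "det_Delta0 N \<alpha> \<in> jpoly_over ({1..N} \<times> UNIV) UNIV" if "\<alpha> \<in> ?A" for \<alpha>
    using belongs[OF that] unfolding belongs_H0_def jpoly_over_def by blast
  have "\<forall>\<alpha>\<in>?A. u \<alpha> = 0" if "(\<Sum>\<alpha>\<in>?A. section_scale (u \<alpha>) (s \<alpha>)) = 0" for u
    by (rule det_Delta0_independent[OF section_independent_of_jpoly[OF fin over s(2) that]])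
  note indep = section_space.independent_familyI[OF fin this]
  have "enat (card (s ` ?A)) \<le> section_edim (H0_GG N k d)"
    using s(1) by (intro section_edim_ge_card indep) auto
  \<comment> \<open>Injectivity of the family turns the number of tuples into the number of
    independent sections.\<close>
  then have "enat ((N + 1) ^ d) \<le> section_edim (H0_GG N k d)"
    by (simp add: card_image[OF indep(1)] card_BNplus_below)
  moreover have "inj_on (det_Delta0 N) ?A" "jpoly_space.independent (det_Delta0 N ` ?A)"
    using jpoly_space.independent_familyI[OF fin det_Delta0_independent] by auto
  moreover have "\<forall>\<alpha>\<in>BNplus N. max_entry N \<alpha> \<le> int d - 1 \<longrightarrow> belongs_H0 N k d (det_Delta0 N \<alpha>)"
    using belongs BNplus_max_entry[of N d] by blast
  ultimately show ?thesis
    unfolding BNplus_max_entry by blast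
qed

end
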